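(* Consider the Cartan group $\mathfrak{C}$, fix $x_0\in\mathbb{R}^5$, and for $\lambda\in C=T^*_{x_0}\mathbb{R}^5\cap\{H=\frac12\}$ let $\gamma$ be the normal geodesic $\gamma(t)=\pi(e^{t\vec H}(\lambda))$, $t\in\mathbb{R}$. With the partition $C=\bigcup_{i=1}^7C_i$ (defined in the context): - for initial covectors $\lambda\in C_1$ there exists an infinite set of times of loss of equiregularity of $\gamma$; - for $\lambda\in C_2\cup C_3\cup C_6$ the geodesic is equiregular for all times; - for $\lambda\in C_4\cup C_5\cup C_7$ the geodesic is not ample, and thus abnormal.
   Context: The Cartan group. $\mathfrak{C}$ is the simply connected nilpotent Lie group, with underlying manifold $\mathbb{R}^5$, whose Lie algebra of left-invariant vector fields is $\mathrm{span}\{X_1,\dots,X_5\}$ with $[X_1,X_2]=X_3$, $[X_1,X_3]=X_4$, $[X_2,X_3]=X_5$ and all other brackets zero. It carries the sub-Riemannian structure $\mathscr{D}=\mathrm{span}\{X_1,X_2\}$ with $X_1,X_2$ orthonormal. Normal and abnormal geodesics. $h_i(\lambda)=\langle\lambda,X_i\rangle$ for $\lambda\in T^*\mathbb{R}^5$, $H=\frac12(h_1^2+h_2^2)$; for a function $a$, $\vec a$ is its Hamiltonian vector field, $da=\sigma(\cdot,\vec a)$, $\sigma$ the differential of the Liouville form; $\pi$ is the bundle projection. A normal geodesic is the projection of an integral curve of $\vec H$. A geodesic with $\dot\gamma=u_1X_1+u_2X_2$ is abnormal if there is a nowhere-zero Lipschitz curve $\eta(t)\in T^*_{\gamma(t)}\mathbb{R}^5$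 with $\dot\eta=u_1\vec h_1(\eta)+u_2\vec h_2(\eta)$ and $h_1(\eta)=h_2(\eta)=0$. Flag. Choose a horizontal vector field $\mathsf T$ with $\mathsf T|_{\gamma(t)}=\dot\gamma(t)$. The flag is $\mathscr{F}^i_\gamma(t)=\mathrm{span}\{\mathcal{L}^j_{\mathsf T}(X)|_{\gamma(t)}: X\text{ a horizontal vector field},\ j\le i-1\}$ (independent of $\mathsf T$), where $\mathcal L_{\mathsf T}$ is the Lie derivative, and the growth vector is the sequence of dimensions $\dim\mathscr{F}^i_\gamma(t)$, $i\ge1$. $\gamma$ is equiregular at $t$ if the growth vector is locally constant at $t$, and ample at $t$ if $\mathscr{F}^m_\gamma(t)=T_{\gamma(t)}\mathbb{R}^5$ for some $m$; it is ample if it is so at every $t$. A time of loss of equiregularity is a time $t$ at which $\gamma$ is not equiregular. Partition. On $C$ use coordinates $(\theta,c,\alpha,\beta)$, $\theta,\beta\in S^1$, $c\in\mathbb{R}$, $\alpha\ge0$: $h_1=\cos\theta$, $h_2=\sin\theta$, $h_3=c$, $h_4=\alpha\sin\beta$, $h_5=-\alpha\cos\beta$, and let $E=\frac{h_3^2}{2}+h_1h_5-h_2h_4=\frac{c^2}{2}-\alpha\cos(\theta-\beta)\in[-\alpha,\infty)$. Then $C_1=\{\alpha\ne0,\ E\in(-\alpha,\alpha)\}$, $C_2=\{\alpha\ne0,\ E\in(\alpha,+\infty)\}$, $C_3=\{\alpha\ne0,\ E=\alpha,\ \theta-\beta\ne\pi\}$, $C_4=\{\alpha\ne0,\ E=-\alpha\}$,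 $C_5=\{\alpha\ne0,\ E=\alpha,\ \theta-\beta=\pi\}$, $C_6=\{\alpha=0,\ c\ne0\}$, $C_7=\{\alpha=c=0\}$ (when $\alpha=0$ the angle $\beta$ is irrelevant). *)

theory Defs
  imports "HOL-Analysis.Analysis" "HOL-Library.Real_Mod"
begin

section \<open>Smooth maps, Lie brackets and the Cartan group\<close>

text \<open>Smoothness is used on open sets only, where it means that all iterated directional
  derivatives exist, are differentiable and continuous.\<close>

primrec C_diff_on ::
    "nat \<Rightarrow> 'a::real_normed_vector set \<Rightarrow> ('a \<Rightarrow> 'b::real_normed_vector) \<Rightarrow> bool" where
  "C_diff_on 0 S f \<longleftrightarrow> continuous_on S f"
| "C_diff_on (Suc k) S f \<longleftrightarrow>
     (\<forall>x\<in>S. f differentiable (at x)) \<and> (\<forall>v. C_diff_on k S (\<lambda>x. frechet_derivative f (at x) v))"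

definition smooth_on ::
    "'a::real_normed_vector set \<Rightarrow> ('a \<Rightarrow> 'b::real_normed_vector) \<Rightarrow> bool" where
  "smooth_on S f \<longleftrightarrow> (\<forall>k. C_diff_on k S f)"

type_synonym field5 = "real^5 \<Rightarrow> real^5"

text \<open>The usual bracket of vector fields, so that \<open>[V,W] f = V (W f) - W (V f)\<close> on functions;
  it is also the Lie derivative of \<open>W\<close> along \<open>V\<close>.\<close>

definition lie_bracket :: "field5 \<Rightarrow> field5 \<Rightarrow> field5" where
  "lie_bracket V W = (\<lambda>x. frechet_derivative W (at x) (V x) - frechet_derivative V (at x) (W x))"

definition lie_group :: "(real^5 \<Rightarrow> real^5 \<Rightarrow> real^5) \<Rightarrow> bool" where
  "lie_group m \<longleftrightarrow> (\<exists>e inv. Groups.group m e inv \<and>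
     smooth_on UNIV (\<lambda>(x, y). m x y) \<and> smooth_on UNIV inv)"

definition left_invariant :: "(real^5 \<Rightarrow> real^5 \<Rightarrow> real^5) \<Rightarrow> field5 \<Rightarrow> bool" where
  "left_invariant m V \<longleftrightarrow> smooth_on UNIV V \<and>
     (\<forall>g x. frechet_derivative (m g) (at x) (V x) = V (m g x))"

text \<open>A Lie group structure \<open>m\<close> on \<open>\<real>\<^sup>5\<close> together with left-invariant fields \<open>X 1, \<dots>, X 5\<close>
  satisfying the Cartan relations; other values of \<open>X\<close> are irrelevant. Since five left-invariant
  fields span every tangent space iff they form a basis of the Lie algebra, this is the Cartan
  group in an arbitrary choice of global coordinates.\<close>

definition cartan_group :: "(real^5 \<Rightarrow> real^5 \<Rightarrow> real^5) \<Rightarrow> (nat \<Rightarrow> field5) \<Rightarrow> bool" where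
  "cartan_group m X \<longleftrightarrow> lie_group m \<and>
     (\<forall>i\<in>{1..5}. left_invariant m (X i)) \<and>
     (\<forall>x. span ((\<lambda>i. X i x) ` {1..5}) = UNIV) \<and>
     (\<forall>i\<in>{1..5}. \<forall>j\<in>{1..5}. i < j \<longrightarrow> lie_bracket (X i) (X j) =
        (if (i, j) = (1, 2) then X 3
         else if (i, j) = (1, 3) then X 4
         else if (i, j) = (2, 3) then X 5
         else (\<lambda>x. 0)))"

section \<open>The cotangent bundle and geodesics\<close>

text \<open>A covector is a pair \<open>(q, p)\<close> of a base point and a momentum, where \<open>p\<close> acts on tangent
  vectors at \<open>q\<close> through the standard inner product; the bundle projection is \<^const>\<open>fst\<close>.\<close>

type_synonym cotangent5 = "(real^5) \<times> (real^5)"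

definition h :: "(nat \<Rightarrow> field5) \<Rightarrow> nat \<Rightarrow> cotangent5 \<Rightarrow> real" where
  "h X i \<xi> = snd \<xi> \<bullet> X i (fst \<xi>)"

definition Ham :: "(nat \<Rightarrow> field5) \<Rightarrow> cotangent5 \<Rightarrow> real" where
  "Ham X \<xi> = ((h X 1 \<xi>)\<^sup>2 + (h X 2 \<xi>)\<^sup>2) / 2"

text \<open>The differential \<open>\<Sum>i. dp\<^sub>i \<and> dq\<^sub>i\<close> of the Liouville form \<open>\<Sum>i. p\<^sub>i dq\<^sub>i\<close>; it has
  constant coefficients.\<close>

definition symplectic :: "cotangent5 \<Rightarrow> cotangent5 \<Rightarrow> real" where
  "symplectic V W = snd V \<bullet> fst W - snd W \<bullet> fst V"

definition hamiltonian_field :: "(cotangent5 \<Rightarrow> real) \<Rightarrow> cotangent5 \<Rightarrow> cotangent5" where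
  "hamiltonian_field a \<xi> = (THE V. \<forall>W. frechet_derivative a (at \<xi>) W = symplectic W V)"

definition integral_curve ::
    "('a::real_normed_vector \<Rightarrow> 'a) \<Rightarrow> (real \<Rightarrow> 'a) \<Rightarrow> bool" where
  "integral_curve V \<phi> \<longleftrightarrow> (\<forall>t. (\<phi> has_vector_derivative V (\<phi> t)) (at t))"

text \<open>Since curves are parametrized by the whole line, Lipschitz means Lipschitz on every compact
  interval; a differential equation for a Lipschitz curve is meant almost everywhere.\<close>

definition abnormal :: "(nat \<Rightarrow> field5) \<Rightarrow> (real \<Rightarrow> real^5) \<Rightarrow> bool" where
  "abnormal X \<gamma> \<longleftrightarrow> (\<exists>(u1 :: real \<Rightarrow> real) u2 (\<eta> :: real \<Rightarrow> cotangent5).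
     (\<forall>t. (\<gamma> has_vector_derivative u1 t *\<^sub>R X 1 (\<gamma> t) + u2 t *\<^sub>R X 2 (\<gamma> t)) (at t)) \<and>
     (\<forall>t. fst (\<eta> t) = \<gamma> t \<and> snd (\<eta> t) \<noteq> 0) \<and>
     (\<forall>a b. \<exists>L. L-lipschitz_on {a..b} \<eta>) \<and>
     (AE t in lborel. (\<eta> has_vector_derivative
         u1 t *\<^sub>R hamiltonian_field (h X 1) (\<eta> t) + u2 t *\<^sub>R hamiltonian_field (h X 2) (\<eta> t)) (at t)) \<and>
     (\<forall>t. h X 1 (\<eta> t) = 0 \<and> h X 2 (\<eta> t) = 0))"

section \<open>Flag, growth vector, equiregularity and ampleness\<close>

definition horizontal_on :: "(nat \<Rightarrow> field5) \<Rightarrow> (real^5) set \<Rightarrow> field5 \<Rightarrow> bool" where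
  "horizontal_on X U Y \<longleftrightarrow> smooth_on U Y \<and> (\<forall>x\<in>U. Y x \<in> span {X 1 x, X 2 x})"

text \<open>An extension of the velocity is required only near the point \<open>\<gamma> t\<close> and for times near
  \<open>t\<close>: a global one need not exist if \<open>\<gamma>\<close> intersects itself.\<close>

definition velocity_extension ::
    "(nat \<Rightarrow> field5) \<Rightarrow> (real \<Rightarrow> real^5) \<Rightarrow> real \<Rightarrow> (real^5) set \<Rightarrow> field5 \<Rightarrow> bool" where
  "velocity_extension X \<gamma> t U T \<longleftrightarrow> open U \<and> \<gamma> t \<in> U \<and> horizontal_on X U T \<and>
     (\<forall>\<^sub>F s in nhds t. (\<gamma> has_vector_derivative T (\<gamma> s)) (at s))"

text \<open>The flag does not depend on the extension \<open>T\<close>, so all extensions are allowed at once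
  instead of choosing one.\<close>

definition flag :: "(nat \<Rightarrow> field5) \<Rightarrow> (real \<Rightarrow> real^5) \<Rightarrow> nat \<Rightarrow> real \<Rightarrow> (real^5) set" where
  "flag X \<gamma> i t = span {((lie_bracket T ^^ j) Y) (\<gamma> t) | T Y U j.
     velocity_extension X \<gamma> t U T \<and> horizontal_on X U Y \<and> j \<le> i - 1}"

definition equiregular_at :: "(nat \<Rightarrow> field5) \<Rightarrow> (real \<Rightarrow> real^5) \<Rightarrow> real \<Rightarrow> bool" where
  "equiregular_at X \<gamma> t \<longleftrightarrow>
     (\<forall>\<^sub>F s in nhds t. \<forall>i\<ge>1. dim (flag X \<gamma> i s) = dim (flag X \<gamma> i t))"

definition ample_at :: "(nat \<Rightarrow> field5) \<Rightarrow> (real \<Rightarrow> real^5) \<Rightarrow> real \<Rightarrow> bool" where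
  "ample_at X \<gamma> t \<longleftrightarrow> (\<exists>i\<ge>1. flag X \<gamma> i t = UNIV)"

definition ample :: "(nat \<Rightarrow> field5) \<Rightarrow> (real \<Rightarrow> real^5) \<Rightarrow> bool" where
  "ample X \<gamma> \<longleftrightarrow> (\<forall>t. ample_at X \<gamma> t)"

section \<open>The partition of the initial cylinder\<close>

definition cylinder :: "(nat \<Rightarrow> field5) \<Rightarrow> real^5 \<Rightarrow> cotangent5 set" where
  "cylinder X x0 = {\<xi>. fst \<xi> = x0 \<and> Ham X \<xi> = 1 / 2}"

text \<open>The angles \<open>\<theta>, \<beta> \<in> S\<^sup>1\<close> are represented by reals modulo \<open>2\<pi>\<close>; when \<open>\<alpha> = 0\<close>, every
  \<open>\<beta>\<close> is admissible.\<close>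

definition coords ::
    "(nat \<Rightarrow> field5) \<Rightarrow> cotangent5 \<Rightarrow> real \<Rightarrow> real \<Rightarrow> real \<Rightarrow> real \<Rightarrow> bool" where
  "coords X \<xi> \<theta> c \<alpha> \<beta> \<longleftrightarrow> \<alpha> \<ge> 0 \<and> h X 1 \<xi> = cos \<theta> \<and> h X 2 \<xi> = sin \<theta> \<and> h X 3 \<xi> = c \<and>
     h X 4 \<xi> = \<alpha> * sin \<beta> \<and> h X 5 \<xi> = - \<alpha> * cos \<beta>"

definition energy :: "(nat \<Rightarrow> field5) \<Rightarrow> cotangent5 \<Rightarrow> real" where
  "energy X \<xi> = (h X 3 \<xi>)\<^sup>2 / 2 + h X 1 \<xi> * h X 5 \<xi> - h X 2 \<xi> * h X 4 \<xi>"

definition C1 :: "(nat \<Rightarrow> field5) \<Rightarrow> real^5 \<Rightarrow> cotangent5 set" where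
  "C1 X x0 = {\<xi>\<in>cylinder X x0. \<exists>\<theta> c \<alpha> \<beta>. coords X \<xi> \<theta> c \<alpha> \<beta> \<and>
     \<alpha> \<noteq> 0 \<and> energy X \<xi> \<in> {-\<alpha><..<\<alpha>}}"

definition C2 :: "(nat \<Rightarrow> field5) \<Rightarrow> real^5 \<Rightarrow> cotangent5 set" where
  "C2 X x0 = {\<xi>\<in>cylinder X x0. \<exists>\<theta> c \<alpha> \<beta>. coords X \<xi> \<theta> c \<alpha> \<beta> \<and>
     \<alpha> \<noteq> 0 \<and> energy X \<xi> \<in> {\<alpha><..}}"

definition C3 :: "(nat \<Rightarrow> field5) \<Rightarrow> real^5 \<Rightarrow> cotangent5 set" where
  "C3 X x0 = {\<xi>\<in>cylinder X x0. \<exists>\<theta> c \<alpha> \<beta>. coords X \<xi> \<theta> c \<alpha> \<beta> \<and>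
     \<alpha> \<noteq> 0 \<and> energy X \<xi> = \<alpha> \<and> \<not> [\<theta> - \<beta> = pi] (rmod (2 * pi))}"

definition C4 :: "(nat \<Rightarrow> field5) \<Rightarrow> real^5 \<Rightarrow> cotangent5 set" where
  "C4 X x0 = {\<xi>\<in>cylinder X x0. \<exists>\<theta> c \<alpha> \<beta>. coords X \<xi> \<theta> c \<alpha> \<beta> \<and>
     \<alpha> \<noteq> 0 \<and> energy X \<xi> = - \<alpha>}"

definition C5 :: "(nat \<Rightarrow> field5) \<Rightarrow> real^5 \<Rightarrow> cotangent5 set" where
  "C5 X x0 = {\<xi>\<in>cylinder X x0. \<exists>\<theta> c \<alpha> \<beta>. coords X \<xi> \<theta> c \<alpha> \<beta> \<and>
     \<alpha> \<noteq> 0 \<and> energy X \<xi> = \<alpha> \<and> [\<theta> - \<beta> = pi] (rmod (2 * pi))}"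

definition C6 :: "(nat \<Rightarrow> field5) \<Rightarrow> real^5 \<Rightarrow> cotangent5 set" where
  "C6 X x0 = {\<xi>\<in>cylinder X x0. \<exists>\<theta> c \<alpha> \<beta>. coords X \<xi> \<theta> c \<alpha> \<beta> \<and> \<alpha> = 0 \<and> c \<noteq> 0}"

definition C7 :: "(nat \<Rightarrow> field5) \<Rightarrow> real^5 \<Rightarrow> cotangent5 set" where
  "C7 X x0 = {\<xi>\<in>cylinder X x0. \<exists>\<theta> c \<alpha> \<beta>. coords X \<xi> \<theta> c \<alpha> \<beta> \<and> \<alpha> = 0 \<and> c = 0}"

end

(* Along an extremal the momenta h_1, ..., h_5 obey h_1' = - h_2 h_3, h_2' = h_1 h_3,
   h_3' = h_1 h_4 + h_2 h_5 with h_4, h_5 constant, so h_3 is the angular velocity of a pendulum.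
   In a frame, the X_3, X_4, X_5 coefficients of the iterated brackets L_T^j(Y) evolve along the
   geodesic by a triangular system that depends on T only through its values. Hence the flag is
   span(X_1, X_2), then adds X_3, then h_1 X_4 + h_2 X_5, and the next step adds the derivative
   h_3 (- h_2 X_4 + h_1 X_5) of this vector. So the growth vector is (2, 3, 4, 5) where h_3 does not
   vanish, and the fourth term of the flag is a proper subspace where it does. It remains to decide
   when the angular velocity of the pendulum vanishes: infinitely often for oscillations, never for
   rotations and on the separatrix, always at equilibria. In the last case the covector
   annihilating X_1, X_2, X_3 and h_1 X_4 + h_2 X_5 is an abnormal lift.
   A smooth extension of the velocity exists because the extremal, reparametrized by a linear
   function of the base point, still solves a smooth autonomous equation. *)
theory Submission
  imports Defs
begin

section \<open>Closure properties of smooth maps\<close>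

text \<open>The flag is a span over all extensions \<open>T\<close> and all sections
  \<open>Y\<close>, so its two bounds have different shapes. An upper bound must hold for every
  choice: coefficient identities valid on an open set of times are differentiated, and each
  derivative yields the identity for the next bracket. The coefficients of proper brackets along
  \<open>X 1\<close> and \<open>X 2\<close> do depend on derivatives of \<open>T\<close>, but they
  are never evaluated. A lower bound needs one good choice, and only there is the existence of a
  smooth extension at stake. The fifth dimension is detected by a single covector, h_1 \<omega>_5 -
  h_2 \<omega>_4, whose pairing with the third bracket is h_3 times the \<open>X 3\<close>
  coefficient of the first one. For oscillations, a zero of h_3 is a jump of the growth vector only
  if h_3 is nonzero nearby; this holds because every such zero is simple. No explicit solution of
  the pendulum is used: oscillation follows by excluding convergence to an equilibrium, and the
  separatrix is handled by uniqueness of solutions.\<close>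

lemma C_diff_on_cong:
  assumes "open S" and "\<And>x. x \<in> S \<Longrightarrow> f x = g x" and "C_diff_on k S f"
  shows "C_diff_on k S g"
  using assms(2,3)
proof (induction k arbitrary: f g)
  case 0
  then show ?case by (simp cong: continuous_on_cong)
next
  case (Suc k)
  have diff: "f differentiable (at x)" if "x \<in> S" for x
    using Suc.prems that by simp
  have fd: "frechet_derivative f (at x) = frechet_derivative g (at x)" if "x \<in> S" for x
    using frechet_derivative_transform_within_open[OF diff[OF that] assms(1) that] Suc.prems(1) by blast
  have gd: "g differentiable (at x)" if "x \<in> S" for x
    using diff[OF that] has_derivative_transform_within_open[OF _ assms(1) that] Suc.prems(1)
    unfolding differentiable_def by blast
  have "C_diff_on k S (\<lambda>x. frechet_derivative g (at x) v)" for v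
    using Suc.IH[of "\<lambda>x. frechet_derivative f (at x) v" "\<lambda>x. frechet_derivative g (at x) v"] fd Suc.prems(2) 
    by simp
  with gd show ?case by simp
qed

text \<open>Openness of \<open>S\<close> lets an explicit derivative, known only on
  \<open>S\<close>, replace \<open>frechet_derivative\<close> in the recursion; the closure lemmas
  below rest on this.\<close>

lemma C_diff_on_SucI:
  assumes "open S" and "\<And>x. x \<in> S \<Longrightarrow> (f has_derivative f' x) (at x)"
    and "\<And>v. C_diff_on k S (\<lambda>x. f' x v)"
  shows "C_diff_on (Suc k) S f"
proof -
  have "C_diff_on k S (\<lambda>x. frechet_derivative f (at x) v)" for v
    using frechet_derivative_at[OF assms(2)]
    by (intro C_diff_on_cong[OF assms(1) _ assms(3)[of v]]) (simp add: fun_eq_iff)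
  then show ?thesis
    using assms(2) by (auto simp: differentiable_def)
qed

lemma C_diff_on_has_derivative:
  "C_diff_on (Suc k) S f \<Longrightarrow> x \<in> S \<Longrightarrow> (f has_derivative frechet_derivative f (at x)) (at x)"
  by (simp add: frechet_derivative_works)

lemma C_diff_on_Suc_lower: "C_diff_on (Suc k) S f \<Longrightarrow> C_diff_on k S f"
proof (induction k arbitrary: f)
  case 0
  then show ?case
    by (auto intro!: continuous_at_imp_continuous_on differentiable_imp_continuous_within)
next
  case (Suc k)
  have "C_diff_on (Suc k) S (\<lambda>x. frechet_derivative f (at x) v)" for v
    using Suc.prems by (simp only: C_diff_on.simps(2)[of "Suc k"])
  then show ?case
    using Suc.prems Suc.IH by (simp only: C_diff_on.simps(2)) blast
qed

lemma C_diff_on_subset: "C_diff_on k S f \<Longrightarrow> S' \<subseteq> S \<Longrightarrow> C_diff_on k S' f"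
proof (induction k arbitrary: f)
  case (Suc k)
  then show ?case by (simp add: subset_iff)
qed (auto intro: continuous_on_subset)

lemma C_diff_on_const: "open S \<Longrightarrow> C_diff_on k S (\<lambda>x. a)"
proof (induction k arbitrary: a)
  case (Suc k)
  then show ?case by (intro C_diff_on_SucI[where f' = "\<lambda>x v. 0"]) auto
qed simp

lemma C_diff_on_bounded_linear:
  assumes "bounded_linear L" "open S" "C_diff_on k S f"
  shows "C_diff_on k S (\<lambda>x. L (f x))"
  using assms(3)
proof (induction k arbitrary: f)
  case 0
  then show ?case by (simp add: bounded_linear.continuous_on[OF assms(1)])
next
  case (Suc k)
  show ?case
  proof (rule C_diff_on_SucI[OF assms(2)])
    show "((\<lambda>x. L (f x)) has_derivative (\<lambda>v. L (frechet_derivative f (at x) v))) (at x)"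
      if "x \<in> S" for x
      by (rule bounded_linear.has_derivative[OF assms(1)])
         (rule C_diff_on_has_derivative[OF Suc.prems that])
  qed (use Suc in simp)
qed

lemma C_diff_on_linear:
  assumes "bounded_linear L" "open S" shows "C_diff_on k S L"
proof (cases k)
  case 0
  then show ?thesis by (simp add: linear_continuous_on assms)
next
  case (Suc n)
  show ?thesis
    unfolding Suc
    by (rule C_diff_on_SucI[OF assms(2), where f' = "\<lambda>x. L"])
       (simp_all add: bounded_linear_imp_has_derivative assms C_diff_on_const)
qed

lemma C_diff_on_add:
  assumes "open S" "C_diff_on k S f" "C_diff_on k S g"
  shows "C_diff_on k S (\<lambda>x. f x + g x)"
  using assms(2,3)
proof (induction k arbitrary: f g)
  case 0
  then show ?case by (auto intro: continuous_on_add)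
next
  case (Suc k)
  show ?case
    by (rule C_diff_on_SucI[OF assms(1), where
          f' = "\<lambda>x v. frechet_derivative f (at x) v + frechet_derivative g (at x) v"])
      (use Suc in \<open>auto intro!: has_derivative_add C_diff_on_has_derivative\<close>)
qed

lemma C_diff_on_sum:
  assumes "open S" "\<And>i. i \<in> I \<Longrightarrow> C_diff_on k S (f i)"
  shows "C_diff_on k S (\<lambda>x. \<Sum>i\<in>I. f i x)"
  using assms(2)
  by (induction I rule: infinite_finite_induct)
     (auto intro!: C_diff_on_add C_diff_on_const assms(1))

lemma C_diff_on_bilinear:
  assumes "bounded_bilinear B" "open S" "C_diff_on k S f" "C_diff_on k S g"
  shows "C_diff_on k S (\<lambda>x. B (f x) (g x))"
  using assms(3,4)
proof (induction k arbitrary: f g)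
  case 0
  then show ?case by (auto intro: bounded_bilinear.continuous_on[OF assms(1)])
next
  case (Suc k)
  show ?case
  proof (rule C_diff_on_SucI[OF assms(2)])
    show "((\<lambda>x. B (f x) (g x)) has_derivative
      (\<lambda>v. B (f x) (frechet_derivative g (at x) v) + B (frechet_derivative f (at x) v) (g x))) (at x)"
      if "x \<in> S" for x
      by (rule bounded_bilinear.FDERIV[OF assms(1) C_diff_on_has_derivative[OF Suc.prems(1) that]
            C_diff_on_has_derivative[OF Suc.prems(2) that]])
    show "C_diff_on k S (\<lambda>x. B (f x) (frechet_derivative g (at x) v) + B (frechet_derivative f (at x) v) (g x))" for v
      using Suc.prems
      by (intro C_diff_on_add Suc.IH assms(2)) (auto intro: C_diff_on_Suc_lower)
  qed
qed

lemmas C_diff_on_scaleR = C_diff_on_bilinear[OF bounded_bilinear_scaleR]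
lemmas C_diff_on_inner = C_diff_on_bilinear[OF bounded_bilinear_inner]
lemmas C_diff_on_mult = C_diff_on_bilinear[OF bounded_bilinear_mult]

lemma C_diff_on_minus:
  assumes "open S" "C_diff_on k S f" shows "C_diff_on k S (\<lambda>x. - f x)"
  by (rule C_diff_on_bounded_linear[OF _ assms]) (simp add: bounded_linear_minus)

lemma C_diff_on_diff:
  assumes "open S" "C_diff_on k S f" "C_diff_on k S g" shows "C_diff_on k S (\<lambda>x. f x - g x)"
  using C_diff_on_add[OF assms(1,2) C_diff_on_minus[OF assms(1,3)]] by simp

text \<open>The derivative is a product of copies of the inverse itself and of a derivative of
  \<open>f\<close>, so the induction closes with \<open>f\<close> fixed.\<close>

lemma C_diff_on_inverse:
  fixes f :: "'a::real_normed_vector \<Rightarrow> real"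
  assumes "open S" "C_diff_on k S f" "\<And>x. x \<in> S \<Longrightarrow> f x \<noteq> 0"
  shows "C_diff_on k S (\<lambda>x. inverse (f x))"
  using assms(2)
proof (induction k)
  case 0
  then show ?case using assms(3) by (auto intro: continuous_on_inverse)
next
  case (Suc k)
  note IH = Suc.IH[OF C_diff_on_Suc_lower[OF Suc.prems]]
  show ?case
  proof (rule C_diff_on_SucI[OF assms(1)])
    show "((\<lambda>x. inverse (f x)) has_derivative
      (\<lambda>v. - (inverse (f x) * frechet_derivative f (at x) v * inverse (f x)))) (at x)"
      if "x \<in> S" for x
      by (rule Deriv.has_derivative_inverse[OF assms(3)[OF that] C_diff_on_has_derivative[OF Suc.prems that]])
    show "C_diff_on k S (\<lambda>x. - (inverse (f x) * frechet_derivative f (at x) v * inverse (f x)))" for v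
      using Suc.prems IH by (intro C_diff_on_minus C_diff_on_mult assms(1)) simp_all
  qed
qed

text \<open>\<open>C_diff_on\<close> speaks of derivatives in constant directions only; a direction
  that moves with the point is expanded in the finite basis.\<close>

lemma C_diff_on_frechet_derivative:
  fixes f :: "'a::euclidean_space \<Rightarrow> 'b::real_normed_vector"
  assumes "open S" "C_diff_on (Suc k) S f" "C_diff_on k S g"
  shows "C_diff_on k S (\<lambda>x. frechet_derivative f (at x) (g x))"
proof (rule C_diff_on_cong[OF assms(1)])
  show "C_diff_on k S (\<lambda>x. \<Sum>b\<in>Basis. (g x \<bullet> b) *\<^sub>R frechet_derivative f (at x) b)"
    using assms by (intro C_diff_on_sum C_diff_on_scaleR C_diff_on_inner C_diff_on_const) auto
next
  fix x assume "x \<in> S"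
  have "bounded_linear (frechet_derivative f (at x))"
    using C_diff_on_has_derivative[OF assms(2) \<open>x \<in> S\<close>] has_derivative_bounded_linear by blast
  then have lin: "linear (frechet_derivative f (at x))" by (rule bounded_linear.linear)
  have "frechet_derivative f (at x) (g x) = frechet_derivative f (at x) (\<Sum>b\<in>Basis. (g x \<bullet> b) *\<^sub>R b)"
    by (simp add: euclidean_representation)
  also have "\<dots> = (\<Sum>b\<in>Basis. (g x \<bullet> b) *\<^sub>R frechet_derivative f (at x) b)"
    by (simp add: linear_sum[OF lin] linear_scale[OF lin])
  finally show "(\<Sum>b\<in>Basis. (g x \<bullet> b) *\<^sub>R frechet_derivative f (at x) b) = frechet_derivative f (at x) (g x)" ..
qed

text \<open>In the chain rule the direction moves with the point. Expanding it in the basis leaves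
  the partial derivatives of \<open>f\<close> composed with \<open>g\<close>, to which the induction
  hypothesis applies.\<close>

lemma C_diff_on_compose:
  fixes g :: "'a::real_normed_vector \<Rightarrow> 'b::euclidean_space"
  assumes "open S" "open V" "g ` S \<subseteq> V" "C_diff_on k V f" "C_diff_on k S g"
  shows "C_diff_on k S (\<lambda>x. f (g x))"
  using assms(4,5)
proof (induction k arbitrary: f)
  case 0
  then show ?case using assms(3) continuous_on_compose2 by auto
next
  case (Suc k)
  let ?f' = "\<lambda>y. frechet_derivative f (at y)" and ?g' = "\<lambda>x. frechet_derivative g (at x)"
  have f': "(f has_derivative ?f' (g x)) (at (g x))" if "x \<in> S" for x
    using C_diff_on_has_derivative[OF Suc.prems(1)] that assms(3) by blast
  show ?case
  proof (rule C_diff_on_SucI[OF assms(1)])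
    fix x assume x: "x \<in> S"
    have "((\<lambda>x. f (g x)) has_derivative (\<lambda>v. ?f' (g x) (?g' x v))) (at x)"
      using has_derivative_compose[OF C_diff_on_has_derivative[OF Suc.prems(2) x] f'[OF x]] .
    also have "(\<lambda>v. ?f' (g x) (?g' x v)) = (\<lambda>v. \<Sum>b\<in>Basis. (?g' x v \<bullet> b) *\<^sub>R ?f' (g x) b)"
    proof
      fix v
      have lin: "linear (?f' (g x))"
        using f'[OF x] has_derivative_bounded_linear bounded_linear.linear by blast
      have "?f' (g x) (?g' x v) = ?f' (g x) (\<Sum>b\<in>Basis. (?g' x v \<bullet> b) *\<^sub>R b)"
        by (simp add: euclidean_representation)
      then show "?f' (g x) (?g' x v) = (\<Sum>b\<in>Basis. (?g' x v \<bullet> b) *\<^sub>R ?f' (g x) b)"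
        by (simp add: linear_sum[OF lin] linear_scale[OF lin])
    qed
    finally show "((\<lambda>x. f (g x)) has_derivative (\<lambda>v. \<Sum>b\<in>Basis. (?g' x v \<bullet> b) *\<^sub>R ?f' (g x) b)) (at x)" .
  next
    show "C_diff_on k S (\<lambda>x. \<Sum>b\<in>Basis. (?g' x v \<bullet> b) *\<^sub>R ?f' (g x) b)" for v
      using Suc.prems
      by (intro C_diff_on_sum C_diff_on_scaleR C_diff_on_inner C_diff_on_const assms(1)
          Suc.IH[of "\<lambda>y. frechet_derivative f (at y) b" for b])
        (auto intro: C_diff_on_Suc_lower)
  qed
qed

text \<open>Bootstrapping: if \<open>Z\<close> is of class \<open>C\<^sup>k\<close>, then so is \<open>Z' = F \<circ> Z\<close>.\<close>

lemma C_diff_on_integral_curve: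
  fixes Z :: "real \<Rightarrow> 'b::euclidean_space"
  assumes "open J" "open V" "Z ` J \<subseteq> V" "\<And>k. C_diff_on k V F"
    and "\<And>r. r \<in> J \<Longrightarrow> (Z has_vector_derivative F (Z r)) (at r)"
  shows "C_diff_on k J Z"
proof (induction k)
  case 0
  then show ?case
    using assms(5) by (auto intro!: continuous_at_imp_continuous_on has_vector_derivative_continuous)
next
  case (Suc k)
  have "C_diff_on k J (\<lambda>r. F (Z r))"
    by (rule C_diff_on_compose[OF assms(1-4) Suc])
  then show ?case
    using assms(5)
    by (intro C_diff_on_SucI[OF assms(1), where f' = "\<lambda>r v. v *\<^sub>R F (Z r)"]
         C_diff_on_scaleR C_diff_on_const assms(1))
       (auto simp: has_vector_derivative_def)
qed

section \<open>The dual coframe\<close>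

lemma differentiable_det:
  fixes A :: "'a::real_normed_vector \<Rightarrow> real^'n^'n"
  assumes "\<And>i j. (\<lambda>x. A x $ i $ j) differentiable (at x)"
  shows "(\<lambda>x. det (A x)) differentiable (at x)"
proof -
  obtain A' where A': "((\<lambda>x. A x $ i $ j) has_derivative A' i j) (at x)" for i j
    using assms unfolding differentiable_def by metis
  have "(\<lambda>x. \<Prod>i\<in>UNIV. A x $ i $ p i) differentiable (at x)" for p
    using has_derivative_prod[of UNIV "\<lambda>i x. A x $ i $ p i", OF A'] by (rule differentiableI)
  then show ?thesis unfolding det_def by (intro differentiable_sum differentiable_mult) auto
qed

text \<open>Cramer's rule writes the dual vectors as quotients of determinants in the frame, which
  makes them differentiable. First derivatives of the coframe are all that is taken later.\<close>

lemma dual_frame_exists: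
  fixes X :: "'n::finite \<Rightarrow> 'a::real_normed_vector \<Rightarrow> real^'n"
  assumes diff: "\<And>i x. X i differentiable (at x)"
    and span: "\<And>x. span (range (\<lambda>i. X i x)) = UNIV"
  obtains \<omega> :: "'n \<Rightarrow> 'a \<Rightarrow> real^'n" where "\<And>k x. \<omega> k differentiable (at x)"
    and "\<And>k j x. \<omega> k x \<bullet> X j x = (if j = k then 1 else 0)"
    and "\<And>x v. v = (\<Sum>j\<in>UNIV. (\<omega> j x \<bullet> v) *\<^sub>R X j x)"
proof -
  define A where "A x = (\<chi> i. X i x)" for x
  define \<omega> where "\<omega> k x = (\<chi> l. det (\<chi> i j. if j = l then axis k 1 $ i else A x $ i $ j) / det (A x))"
    for k x
  have "rows (A x) = range (\<lambda>i. X i x)" for x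
    by (auto simp: rows_def A_def row_def vec_nth_inverse)
  then have "\<exists>B. B ** A x = mat 1" for x
    using matrix_left_invertible_span_rows[of "A x"] span by simp
  then have "invertible (A x)" for x
    using matrix_left_right_inverse unfolding invertible_def by metis
  then have det: "det (A x) \<noteq> 0" for x
    by (simp add: invertible_det_nz)
  have entry: "(\<lambda>x. A x $ i $ j) differentiable (at x)" for i j x
  proof -
    obtain D where "(X i has_derivative D) (at x)"
      using diff unfolding differentiable_def by blast
    from bounded_linear.has_derivative[OF bounded_linear_vec_nth this, of j] show ?thesis
      by (auto simp: A_def differentiable_def)
  qed
  have \<omega>_diff: "\<omega> k differentiable (at x)" for k x
  proof -
    have "(\<lambda>x. det (\<chi> i j. if j = l then axis k 1 $ i else A x $ i $ j)) differentiable (at x)" for l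
    proof (rule differentiable_det)
      show "(\<lambda>x. (\<chi> i j. if j = l then axis k 1 $ i else A x $ i $ j) $ i $ j) differentiable (at x)" for i j
        using entry[of i j x] by (cases "j = l") auto
    qed
    then have comp: "(\<lambda>x. \<omega> k x $ l) differentiable (at x)" for l
      using differentiable_divide[OF _ differentiable_det[of A x, OF entry] det]
      by (simp add: \<omega>_def)
    have "(\<lambda>x. \<omega> k x \<bullet> b) differentiable (at x)" if "b \<in> Basis" for b
      using that comp by (auto simp: Basis_vec_def inner_axis)
    then show ?thesis by (subst differentiable_componentwise_within) blast
  qed
  have dual: "\<omega> k x \<bullet> X j x = (if j = k then 1 else 0)" for k j x
  proof -
    have "A x *v \<omega> k x = axis k 1"
      unfolding cramer[OF det] \<omega>_def ..
    then have "(A x *v \<omega> k x) $ j = axis k 1 $ j" by simp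
    then show ?thesis
      by (simp add: matrix_vector_mult_def A_def axis_def inner_vec_def mult.commute)
  qed
  have "v = (\<Sum>j\<in>UNIV. (\<omega> j x \<bullet> v) *\<^sub>R X j x)" for v x
  proof -
    have "v \<in> span (range (\<lambda>i. X i x))" by (simp add: span)
    then show ?thesis
    proof (induction rule: span_induct)
      case base
      have "linear (\<lambda>a. a - (\<Sum>j\<in>UNIV. (\<omega> j x \<bullet> a) *\<^sub>R X j x))"
        by (rule linearI) (simp_all add: inner_add_right scaleR_left_distrib sum.distrib
            scaleR_sum_right scaleR_diff_right)
      from linear_subspace_kernel[OF this] show ?case by simp
    next
      case step
      then show ?case by (auto simp: dual if_distrib[of "\<lambda>c. c *\<^sub>R _"] cong: if_cong)
    qed
  qed
  with \<omega>_diff dual that show ?thesis by blast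
qed

lemma atLeastAtMost_1_5: "{1..5::nat} = {1, 2, 3, 4, 5}"
  by auto

text \<open>The data extracted from the group: a global smooth frame with its bracket relations,
  completed by the dual coframe that reads off coefficients.\<close>

locale cartan_frame =
  fixes X :: "nat \<Rightarrow> field5" and \<omega> :: "nat \<Rightarrow> field5"
  assumes X_smooth: "\<And>i. i \<in> {1..5} \<Longrightarrow> smooth_on UNIV (X i)"
    and coframe_differentiable: "\<And>k x. k \<in> {1..5} \<Longrightarrow> \<omega> k differentiable (at x)"
    and dual: "\<And>k j x. k \<in> {1..5} \<Longrightarrow> j \<in> {1..5} \<Longrightarrow> \<omega> k x \<bullet> X j x = (if j = k then 1 else 0)"
    and expand: "\<And>x v. (\<Sum>j\<in>{1..5}. (\<omega> j x \<bullet> v) *\<^sub>R X j x) = v"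
    and brackets: "\<And>i j. i \<in> {1..5} \<Longrightarrow> j \<in> {1..5} \<Longrightarrow> i < j \<Longrightarrow> lie_bracket (X i) (X j) =
        (if (i, j) = (1, 2) then X 3
         else if (i, j) = (1, 3) then X 4
         else if (i, j) = (2, 3) then X 5
         else (\<lambda>x. 0))"

lemma cartan_group_coframe:
  assumes "cartan_group m X"
  obtains \<omega> where "cartan_frame X \<omega>"
proof -
  \<comment> \<open>The fields are indexed by natural numbers, matrices by the type
    \<open>5\<close>; a bijection \<open>b\<close> with inverse \<open>c\<close> carries the dual
    frame from one to the other.\<close>
  have "card {1..5::nat} = card (UNIV :: 5 set)" by simp
  then obtain b :: "nat \<Rightarrow> 5" where b: "bij_betw b {1..5} UNIV"
    using finite_same_card_bij by (metis finite finite_atLeastAtMost)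
  define c where "c = the_inv_into {1..5} b"
  have c: "bij_betw c UNIV {1..5}"
    unfolding c_def using b by (rule bij_betw_the_inv_into)
  have cb: "c (b k) = k" if "k \<in> {1..5}" for k
    using b that unfolding c_def by (simp add: bij_betw_def the_inv_into_f_f)
  have c_range: "c ` UNIV = {1..5}" using c by (simp add: bij_betw_def)
  have c_mem: "c i \<in> {1..5}" for i using c_range by blast
  have smooth: "smooth_on UNIV (X i)" if "i \<in> {1..5}" for i
    using assms that by (simp add: cartan_group_def left_invariant_def)
  have diff: "X (c i) differentiable (at x)" for i x
  proof -
    have "C_diff_on (Suc 0) UNIV (X (c i))"
      using smooth[OF c_mem] unfolding smooth_on_def by blast
    then show ?thesis by simp
  qed
  have span: "span (range (\<lambda>i. X (c i) x)) = UNIV" for x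
  proof -
    have "range (\<lambda>i. X (c i) x) = (\<lambda>i. X i x) ` (c ` UNIV)" by (simp add: image_image)
    then show ?thesis using assms unfolding c_range by (simp add: cartan_group_def)
  qed
  obtain \<omega> where \<omega>: "\<And>k x. \<omega> k differentiable (at x)"
    "\<And>k j x. \<omega> k x \<bullet> X (c j) x = (if j = k then 1 else 0)"
    "\<And>x v. v = (\<Sum>j\<in>UNIV. (\<omega> j x \<bullet> v) *\<^sub>R X (c j) x)"
    using dual_frame_exists[of "\<lambda>i. X (c i)", OF diff span] by blast
  have b_eq: "(b j = b k) = (j = k)" if "j \<in> {1..5}" "k \<in> {1..5}" for j k
    using b that by (meson bij_betw_def inj_on_eq_iff)
  show ?thesis
  proof (rule that, unfold_locales)
    show "(\<lambda>k. \<omega> (b k)) k differentiable (at x)" for k x using \<omega>(1) by simp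
    show "(\<lambda>k. \<omega> (b k)) k x \<bullet> X j x = (if j = k then 1 else 0)" if "k \<in> {1..5}" "j \<in> {1..5}" for k j x
      using \<omega>(2)[where j = "b j" and k = "b k"] that by (simp add: cb b_eq del: atLeastAtMost_iff)
    show "(\<Sum>j\<in>{1..5}. ((\<lambda>k. \<omega> (b k)) j x \<bullet> v) *\<^sub>R X j x) = v" for x v
    proof -
      have "(\<Sum>j\<in>{1..5}. (\<omega> (b j) x \<bullet> v) *\<^sub>R X j x)
        = (\<Sum>j\<in>{1..5}. (\<omega> (b j) x \<bullet> v) *\<^sub>R X (c (b j)) x)"
        by (rule sum.cong) (simp_all only: cb)
      also have "\<dots> = (\<Sum>j\<in>UNIV. (\<omega> j x \<bullet> v) *\<^sub>R X (c j) x)"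
        by (rule sum.reindex_bij_betw[OF b])
      finally show ?thesis using \<omega>(3)[of v x] by simp
    qed
    show "smooth_on UNIV (X i)" if "i \<in> {1..5}" for i by (rule smooth[OF that])
  next
    fix i j :: nat
    assume "i \<in> {1..5}" "j \<in> {1..5}" "i < j"
    then show "lie_bracket (X i) (X j) =
        (if (i, j) = (1, 2) then X 3 else if (i, j) = (1, 3) then X 4
         else if (i, j) = (2, 3) then X 5 else (\<lambda>x. 0))"
      using assms unfolding cartan_group_def by blast
  qed
qed

section \<open>Brackets expressed in the frame\<close>

lemma lie_bracket_commute: "lie_bracket V W x = - lie_bracket W V x"
  by (simp add: lie_bracket_def)

lemma lie_bracket_self: "lie_bracket V V x = 0"
  by (simp add: lie_bracket_def)

context cartan_frame
begin

lemma X_C_diff: "i \<in> {1..5} \<Longrightarrow> C_diff_on k U (X i)"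
  using X_smooth[of i] C_diff_on_subset[of k UNIV "X i" U] by (simp add: smooth_on_def)

lemma X_differentiable: "i \<in> {1..5} \<Longrightarrow> X i differentiable (at x)"
  using X_C_diff[of i "Suc 0" UNIV] by simp

lemma brackets_12:
  "lie_bracket (X 1) (X 1) x = 0" "lie_bracket (X 1) (X 2) x = X 3 x"
  "lie_bracket (X 1) (X 3) x = X 4 x" "lie_bracket (X 1) (X 4) x = 0" "lie_bracket (X 1) (X 5) x = 0"
  "lie_bracket (X 2) (X 1) x = - X 3 x" "lie_bracket (X 2) (X 2) x = 0"
  "lie_bracket (X 2) (X 3) x = X 5 x" "lie_bracket (X 2) (X 4) x = 0" "lie_bracket (X 2) (X 5) x = 0"
  using brackets[of 1 2] brackets[of 1 3] brackets[of 1 4] brackets[of 1 5]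
    brackets[of 2 3] brackets[of 2 4] brackets[of 2 5] lie_bracket_commute[of "X 2" "X 1"]
  by (simp_all add: lie_bracket_self)

lemma expand5:
  "v = (\<omega> 1 x \<bullet> v) *\<^sub>R X 1 x + (\<omega> 2 x \<bullet> v) *\<^sub>R X 2 x + (\<omega> 3 x \<bullet> v) *\<^sub>R X 3 x
     + (\<omega> 4 x \<bullet> v) *\<^sub>R X 4 x + (\<omega> 5 x \<bullet> v) *\<^sub>R X 5 x"
  using expand[of x v] unfolding atLeastAtMost_1_5 by (simp add: add.assoc)

lemma horizontal_coframe:
  assumes "v \<in> span {X 1 x, X 2 x}" "k \<in> {3..5}"
  shows "\<omega> k x \<bullet> v = 0"
proof -
  have "k \<in> {1..5}" "k \<noteq> 1" "k \<noteq> 2" using assms(2) by auto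
  then show ?thesis
    using assms(1) dual[of k 1 x] dual[of k 2 x]
    by (auto simp: span_breakdown_eq inner_diff_right algebra_simps)
qed

text \<open>The derivatives of the coefficients of \<open>T\<close> contribute only horizontal terms, so that the
  coefficients of \<open>[T,W]\<close> along \<open>X 3\<close>, \<open>X 4\<close>, \<open>X 5\<close> depend on \<open>T\<close> only pointwise.\<close>

lemma coframe_lie_bracket:
  assumes "open U" "x \<in> U" "\<And>y. y \<in> U \<Longrightarrow> T y \<in> span {X 1 y, X 2 y}"
    and T: "T differentiable (at x)" and W: "W differentiable (at x)" and k: "k \<in> {3..5}"
  shows "\<omega> k x \<bullet> lie_bracket T W x = frechet_derivative (\<lambda>y. \<omega> k y \<bullet> W y) (at x) (T x)
    + (\<Sum>j\<in>{1..5}. (\<omega> j x \<bullet> W x) * ((\<omega> 1 x \<bullet> T x) * (\<omega> k x \<bullet> lie_bracket (X 1) (X j) x)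
      + (\<omega> 2 x \<bullet> T x) * (\<omega> k x \<bullet> lie_bracket (X 2) (X j) x)))"
proof -
  let ?D = "\<lambda>f. frechet_derivative f (at x)"
  let ?w = "\<lambda>j. \<omega> j x \<bullet> W x"
  define u1 u2 where "u1 = \<omega> 1 x \<bullet> T x" and "u2 = \<omega> 2 x \<bullet> T x"
  have k5: "k \<in> {1..5}" using k by auto
  have product: "?D (\<lambda>y. \<omega> k y \<bullet> f y) v = \<omega> k x \<bullet> ?D f v + ?D (\<omega> k) v \<bullet> f x"
    if "f differentiable (at x)" for f :: field5 and v
  proof -
    have "((\<lambda>y. \<omega> k y \<bullet> f y) has_derivative (\<lambda>v. \<omega> k x \<bullet> ?D f v + ?D (\<omega> k) v \<bullet> f x)) (at x)"
      using that coframe_differentiable[OF k5, of x]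
      by (intro has_derivative_inner) (simp_all add: frechet_derivative_works)
    from frechet_derivative_at[OF this] show ?thesis by (simp add: fun_eq_iff)
  qed
  \<comment> \<open>The pairing with \<open>X j\<close> is constant, so derivatives of the coframe
    can be traded for derivatives of the frame.\<close>
  have DX: "?D (\<omega> k) v \<bullet> X j x = - (\<omega> k x \<bullet> ?D (X j) v)" if "j \<in> {1..5}" for j v
  proof -
    have "?D (\<lambda>y. \<omega> k y \<bullet> X j y) v = 0" using dual[OF k5 that] by simp
    then show ?thesis using product[OF X_differentiable[OF that]] by simp
  qed
  \<comment> \<open>\<open>T\<close> is horizontal on a whole neighbourhood, so its pairing with
    \<open>\<omega> k\<close> vanishes identically there. This removes the derivative of
    \<open>T\<close>.\<close>
  have DT: "?D (\<omega> k) v \<bullet> T x = - (\<omega> k x \<bullet> ?D T v)" for v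
  proof -
    have "((\<lambda>y. \<omega> k y \<bullet> T y) has_derivative (\<lambda>v. 0)) (at x)"
      by (rule has_derivative_transform_within_open[OF has_derivative_const assms(1,2), of 0])
         (simp add: horizontal_coframe[OF assms(3) k])
    then have "?D (\<lambda>y. \<omega> k y \<bullet> T y) v = 0" using frechet_derivative_at by metis
    then show ?thesis using product[OF T] by simp
  qed
  have Tx: "T x = u1 *\<^sub>R X 1 x + u2 *\<^sub>R X 2 x"
    using expand5[of "T x" x] horizontal_coframe[OF assms(3)[OF assms(2)]] by (simp add: u1_def u2_def)
  have linX: "linear (?D (X j))" if "j \<in> {1..5}" for j
    using linear_frechet_derivative[OF X_differentiable[OF that]] .
  have W_sum: "W x = (\<Sum>j\<in>{1..5}. ?w j *\<^sub>R X j x)" by (rule expand[symmetric])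
  have e1: "?D (\<omega> k) (T x) \<bullet> W x
    = - (\<Sum>j\<in>{1..5}. ?w j * (u1 * (\<omega> k x \<bullet> ?D (X j) (X 1 x)) + u2 * (\<omega> k x \<bullet> ?D (X j) (X 2 x))))"
  proof -
    have "?D (\<omega> k) (T x) \<bullet> W x = (\<Sum>j\<in>{1..5}. ?w j * (?D (\<omega> k) (T x) \<bullet> X j x))"
      by (subst W_sum) (simp add: inner_sum_right)
    also have "\<dots> = (\<Sum>j\<in>{1..5}. - (?w j * (u1 * (\<omega> k x \<bullet> ?D (X j) (X 1 x)) + u2 * (\<omega> k x \<bullet> ?D (X j) (X 2 x)))))"
    proof (rule sum.cong)
      fix j :: nat assume j: "j \<in> {1..5}"
      have "?D (X j) (T x) = u1 *\<^sub>R ?D (X j) (X 1 x) + u2 *\<^sub>R ?D (X j) (X 2 x)"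
        by (simp add: Tx linear_add[OF linX[OF j]] linear_scale[OF linX[OF j]])
      then show "?w j * (?D (\<omega> k) (T x) \<bullet> X j x)
        = - (?w j * (u1 * (\<omega> k x \<bullet> ?D (X j) (X 1 x)) + u2 * (\<omega> k x \<bullet> ?D (X j) (X 2 x))))"
        by (simp add: DX[OF j] inner_add_right algebra_simps del: One_nat_def)
    qed simp
    finally show ?thesis by (simp only: sum_negf)
  qed
  have DXi: "\<omega> k x \<bullet> ?D (X i) (W x) = (\<Sum>j\<in>{1..5}. ?w j * (\<omega> k x \<bullet> ?D (X i) (X j x)))"
    if "i \<in> {1..5}" for i
    by (subst W_sum) (simp add: linear_sum[OF linX[OF that]] linear_scale[OF linX[OF that]] inner_sum_right)
  have e2: "?D (\<omega> k) (W x) \<bullet> T x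
    = - (\<Sum>j\<in>{1..5}. ?w j * (u1 * (\<omega> k x \<bullet> ?D (X 1) (X j x)) + u2 * (\<omega> k x \<bullet> ?D (X 2) (X j x))))"
  proof -
    have "?D (\<omega> k) (W x) \<bullet> T x = - (u1 * (\<omega> k x \<bullet> ?D (X 1) (W x)) + u2 * (\<omega> k x \<bullet> ?D (X 2) (W x)))"
      using DX[of 1 "W x"] DX[of 2 "W x"] by (subst Tx) (simp add: inner_add_right)
    then show ?thesis
      using DXi[of 1] DXi[of 2]
      by (simp add: sum_distrib_left sum.distrib[symmetric] algebra_simps del: One_nat_def)
  qed
  \<comment> \<open>Cartan's formula for the exterior derivative of \<open>\<omega> k\<close> on
    \<open>T\<close> and \<open>W\<close>; the term in which \<open>W\<close> differentiates the
    pairing of \<open>\<omega> k\<close> with \<open>T\<close> is zero.\<close>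
  have "\<omega> k x \<bullet> lie_bracket T W x = ?D (\<lambda>y. \<omega> k y \<bullet> W y) (T x) - ?D (\<omega> k) (T x) \<bullet> W x
     + ?D (\<omega> k) (W x) \<bullet> T x"
    by (simp add: product[OF W] DT lie_bracket_def inner_diff_right)
  then show ?thesis
    unfolding e1 e2
    by (simp add: lie_bracket_def inner_diff_right u1_def[symmetric] u2_def[symmetric]
        sum_subtractf[symmetric] sum.distrib[symmetric] algebra_simps del: One_nat_def)
qed

end

section \<open>Hamiltonian vector fields and normal extremals\<close>

text \<open>Nondegeneracy of the symplectic form makes the defining description unique; it is tested
  on purely vertical and purely horizontal vectors.\<close>

lemma hamiltonian_field_eqI:
  assumes "(a has_derivative (\<lambda>W. symplectic W V)) (at \<xi>)"
  shows "hamiltonian_field a \<xi> = V"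
proof -
  have "frechet_derivative a (at \<xi>) = (\<lambda>W. symplectic W V)"
    using frechet_derivative_at[OF assms] by simp
  moreover have "V' = V" if "\<forall>W. symplectic W V = symplectic W V'" for V'
  proof -
    have *: "snd W \<bullet> (fst V - fst V') = (snd V - snd V') \<bullet> fst W" for W
      using that[rule_format, of W] by (simp add: symplectic_def inner_diff_left inner_diff_right)
    have "fst V - fst V' = 0"
      using *[of "(0, fst V - fst V')"] by simp
    moreover have "snd V - snd V' = 0"
      using *[of "(snd V - snd V', 0)"] by simp
    ultimately show ?thesis by (simp add: prod_eq_iff)
  qed
  ultimately show ?thesis
    unfolding hamiltonian_field_def by (intro the_equality) auto
qed

text \<open>The cotangent lift of \<open>V\<close>: the momentum moves by minus the adjoint of the
  derivative of \<open>V\<close>, written out in the basis.\<close>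

definition hvec :: "field5 \<Rightarrow> cotangent5 \<Rightarrow> cotangent5" where
  "hvec V \<xi> = (V (fst \<xi>), - (\<Sum>b\<in>Basis. (snd \<xi> \<bullet> frechet_derivative V (at (fst \<xi>)) b) *\<^sub>R b))"

lemma inner_snd_hvec:
  assumes "V differentiable (at (fst \<xi>))"
  shows "snd (hvec V \<xi>) \<bullet> w = - (snd \<xi> \<bullet> frechet_derivative V (at (fst \<xi>)) w)"
proof -
  note lin = linear_frechet_derivative[OF assms]
  have "frechet_derivative V (at (fst \<xi>)) w
    = frechet_derivative V (at (fst \<xi>)) (\<Sum>b\<in>Basis. (w \<bullet> b) *\<^sub>R b)"
    by (simp add: euclidean_representation)
  also have "\<dots> = (\<Sum>b\<in>Basis. (w \<bullet> b) *\<^sub>R frechet_derivative V (at (fst \<xi>)) b)"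
    by (simp add: linear_sum[OF lin] linear_scale[OF lin])
  finally show ?thesis
    by (simp add: hvec_def inner_sum_left inner_sum_right mult.commute inner_commute)
qed

lemma h_has_derivative:
  assumes "X i differentiable (at (fst \<xi>))"
  shows "(h X i has_derivative (\<lambda>W. symplectic W (hvec (X i) \<xi>))) (at \<xi>)"
proof -
  have "((\<lambda>\<xi>. X i (fst \<xi>)) has_derivative (\<lambda>W. frechet_derivative (X i) (at (fst \<xi>)) (fst W))) (at \<xi>)"
    using assms has_derivative_compose[OF has_derivative_fst[OF has_derivative_ident]]
    by (simp add: frechet_derivative_works)
  then have "((\<lambda>\<xi>. snd \<xi> \<bullet> X i (fst \<xi>)) has_derivative
      (\<lambda>W. snd \<xi> \<bullet> frechet_derivative (X i) (at (fst \<xi>)) (fst W) + snd W \<bullet> X i (fst \<xi>))) (at \<xi>)"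
    by (intro has_derivative_inner has_derivative_snd[OF has_derivative_ident])
  then show ?thesis
    by (simp add: h_def[abs_def] symplectic_def inner_snd_hvec[OF assms]) (simp add: hvec_def add.commute)
qed

lemma hamiltonian_field_h:
  "X i differentiable (at (fst \<xi>)) \<Longrightarrow> hamiltonian_field (h X i) \<xi> = hvec (X i) \<xi>"
  by (intro hamiltonian_field_eqI h_has_derivative)

lemma hamiltonian_field_Ham:
  assumes "X 1 differentiable (at (fst \<xi>))" "X 2 differentiable (at (fst \<xi>))"
  shows "hamiltonian_field (Ham X) \<xi> = h X 1 \<xi> *\<^sub>R hvec (X 1) \<xi> + h X 2 \<xi> *\<^sub>R hvec (X 2) \<xi>"
proof (rule hamiltonian_field_eqI)
  show "(Ham X has_derivative
    (\<lambda>W. symplectic W (h X 1 \<xi> *\<^sub>R hvec (X 1) \<xi> + h X 2 \<xi> *\<^sub>R hvec (X 2) \<xi>))) (at \<xi>)"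
    unfolding Ham_def[abs_def]
    by (auto intro!: derivative_eq_intros h_has_derivative[where X = X and i = 1, OF assms(1)]
          h_has_derivative[where X = X and i = 2, OF assms(2)]
          simp: symplectic_def fun_eq_iff field_simps inner_add_left inner_add_right simp del: One_nat_def)
qed

context cartan_frame
begin

abbreviation Hvec :: "cotangent5 \<Rightarrow> cotangent5" where
  "Hvec \<xi> \<equiv> h X 1 \<xi> *\<^sub>R hvec (X 1) \<xi> + h X 2 \<xi> *\<^sub>R hvec (X 2) \<xi>"

lemma hamiltonian_field_Ham_eq: "hamiltonian_field (Ham X) = Hvec"
  by (rule ext, rule hamiltonian_field_Ham) (simp_all add: X_differentiable)

lemma C_diff_on_X_fst:
  assumes "i \<in> {1..5}" shows "C_diff_on k UNIV (\<lambda>\<xi>::cotangent5. X i (fst \<xi>))"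
  by (rule C_diff_on_compose[OF open_UNIV open_UNIV])
     (simp_all add: X_C_diff[OF assms] C_diff_on_linear bounded_linear_fst)

lemma C_diff_on_h:
  assumes "i \<in> {1..5}" shows "C_diff_on k UNIV (h X i)"
  unfolding h_def[abs_def]
  by (intro C_diff_on_inner C_diff_on_X_fst assms C_diff_on_linear) (simp_all add: bounded_linear_snd)

lemma C_diff_on_hvec:
  assumes "i \<in> {1..5}" shows "C_diff_on k UNIV (hvec (X i))"
proof -
  let ?Y = "\<lambda>\<xi>::cotangent5. - (\<Sum>b\<in>Basis. (snd \<xi> \<bullet> frechet_derivative (X i) (at (fst \<xi>)) b) *\<^sub>R b)"
  have "C_diff_on k UNIV (\<lambda>x. frechet_derivative (X i) (at x) b)" for b
    using X_C_diff[OF assms, of "Suc k" UNIV] by simp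
  then have D: "C_diff_on k UNIV (\<lambda>\<xi>::cotangent5. frechet_derivative (X i) (at (fst \<xi>)) b)" for b
    by (intro C_diff_on_compose[where V = UNIV and g = fst and f = "\<lambda>x. frechet_derivative (X i) (at x) b"])
       (simp_all add: C_diff_on_linear bounded_linear_fst)
  have Y: "C_diff_on k UNIV ?Y"
    by (intro C_diff_on_minus C_diff_on_sum C_diff_on_scaleR C_diff_on_inner D C_diff_on_const
        C_diff_on_linear[OF bounded_linear_snd] open_UNIV)
  have "C_diff_on k UNIV (\<lambda>\<xi>::cotangent5. (X i (fst \<xi>), 0 :: real^5) + (0 :: real^5, ?Y \<xi>))"
    using Y C_diff_on_X_fst[OF assms]
    by (intro C_diff_on_add C_diff_on_bounded_linear[where L = "\<lambda>x. (x, 0)"]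
        C_diff_on_bounded_linear[where L = "\<lambda>x. (0, x)"])
      (simp_all add: bounded_linear_Pair bounded_linear_ident bounded_linear_zero)
  then show ?thesis by (simp add: hvec_def[abs_def])
qed

lemma C_diff_on_Hvec: "C_diff_on k UNIV Hvec"
  by (intro C_diff_on_add C_diff_on_scaleR C_diff_on_h C_diff_on_hvec) simp_all

end

section \<open>Momenta along a normal extremal\<close>

locale normal_extremal = cartan_frame +
  fixes \<phi> :: "real \<Rightarrow> cotangent5" and \<gamma> :: "real \<Rightarrow> real^5"
  assumes \<phi>': "(\<phi> has_vector_derivative Hvec (\<phi> t)) (at t)"
    and \<gamma>_def: "\<gamma> = (\<lambda>t. fst (\<phi> t))"
    and unit_speed: "(h X 1 (\<phi> 0))\<^sup>2 + (h X 2 (\<phi> 0))\<^sup>2 = 1"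
begin

abbreviation hh :: "nat \<Rightarrow> real \<Rightarrow> real" where "hh i t \<equiv> h X i (\<phi> t)"

lemma \<gamma>_derivative:
  "(\<gamma> has_vector_derivative hh 1 t *\<^sub>R X 1 (\<gamma> t) + hh 2 t *\<^sub>R X 2 (\<gamma> t)) (at t)"
proof -
  have "((\<lambda>t. fst (\<phi> t)) has_vector_derivative fst (Hvec (\<phi> t))) (at t)"
    by (rule bounded_linear.has_vector_derivative[OF bounded_linear_fst \<phi>'])
  then show ?thesis by (simp add: \<gamma>_def hvec_def)
qed

text \<open>The derivative is the Poisson bracket with \<open>Ham\<close>, and the Poisson bracket
  of two functions linear on the fibres is the momentum of the Lie bracket of their fields.\<close>

lemma hh_derivative:
  assumes "i \<in> {1..5}"
  shows "(hh i has_real_derivative hh 1 t * (snd (\<phi> t) \<bullet> lie_bracket (X 1) (X i) (\<gamma> t))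
    + hh 2 t * (snd (\<phi> t) \<bullet> lie_bracket (X 2) (X i) (\<gamma> t))) (at t)"
proof -
  let ?p = "snd (\<phi> t)" and ?D = "\<lambda>i. frechet_derivative (X i) (at (fst (\<phi> t)))"
  have diff: "X j differentiable (at x)" if "j \<in> {1..5}" for j x
    using X_differentiable that .
  have "((\<lambda>s. h X i (\<phi> s)) has_derivative (\<lambda>s. symplectic (s *\<^sub>R Hvec (\<phi> t)) (hvec (X i) (\<phi> t)))) (at t)"
    using has_derivative_compose[OF \<phi>'[unfolded has_vector_derivative_def, of t]
        h_has_derivative[where X = X and i = i and \<xi> = "\<phi> t", OF diff[OF assms]]] by simp
  moreover have "symplectic (s *\<^sub>R V) W = symplectic V W * s" for s V W
    by (simp add: symplectic_def algebra_simps)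
  ultimately have d: "(hh i has_real_derivative symplectic (Hvec (\<phi> t)) (hvec (X i) (\<phi> t))) (at t)"
    by (simp add: has_field_derivative_def)
  have "symplectic (hvec (X j) (\<phi> t)) (hvec (X i) (\<phi> t)) = ?p \<bullet> lie_bracket (X j) (X i) (\<gamma> t)"
    if "j \<in> {1..5}" for j
    unfolding symplectic_def inner_snd_hvec[OF diff[OF that]] inner_snd_hvec[OF diff[OF assms]]
    by (simp add: hvec_def lie_bracket_def \<gamma>_def inner_diff_right)
  from this[of 1] this[of 2] have "symplectic (Hvec (\<phi> t)) (hvec (X i) (\<phi> t)) =
    hh 1 t * (?p \<bullet> lie_bracket (X 1) (X i) (\<gamma> t)) + hh 2 t * (?p \<bullet> lie_bracket (X 2) (X i) (\<gamma> t))"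
    by (simp add: symplectic_def algebra_simps)
  with d show ?thesis by simp
qed

lemma snd_\<phi>_X: "snd (\<phi> t) \<bullet> X i (\<gamma> t) = hh i t"
  by (simp add: h_def \<gamma>_def)

lemma hh_derivatives:
  "(hh 1 has_real_derivative - hh 2 t * hh 3 t) (at t)"
  "(hh 2 has_real_derivative hh 1 t * hh 3 t) (at t)"
  "(hh 3 has_real_derivative hh 1 t * hh 4 t + hh 2 t * hh 5 t) (at t)"
  "(hh 4 has_real_derivative 0) (at t)" "(hh 5 has_real_derivative 0) (at t)"
  using hh_derivative[of 1 t] hh_derivative[of 2 t] hh_derivative[of 3 t] hh_derivative[of 4 t]
    hh_derivative[of 5 t]
  by (simp_all only: brackets_12) (simp_all add: snd_\<phi>_X)

lemma hh_const: "hh 4 t = hh 4 0" "hh 5 t = hh 5 0"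
  using hh_derivatives(4,5) by (metis DERIV_isconst_all)+

lemma unit: "(hh 1 t)\<^sup>2 + (hh 2 t)\<^sup>2 = 1"
proof -
  have "((\<lambda>t. (hh 1 t)\<^sup>2 + (hh 2 t)\<^sup>2) has_real_derivative 0) (at t)" for t
    by (rule derivative_eq_intros hh_derivatives refl)+ (simp add: algebra_simps)
  then show ?thesis using unit_speed DERIV_isconst_all[of "\<lambda>t. (hh 1 t)\<^sup>2 + (hh 2 t)\<^sup>2" t 0] by simp
qed

end

section \<open>Smooth extensions of the velocity\<close>

text \<open>An inverse function theorem that gives the derivative of the inverse on all of
  \<open>J\<close>, as required for the change of time in \<open>controls_extend\<close>.\<close>

lemma local_inverse_real:
  fixes f f' :: "real \<Rightarrow> real"
  assumes der: "\<And>s. (f has_real_derivative f' s) (at s)" and cont: "isCont f' t" and pos: "f' t > 0"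
  obtains J \<sigma> where "open J" "\<And>r. r \<in> J \<Longrightarrow> f' (\<sigma> r) > 0"
    "\<And>r. r \<in> J \<Longrightarrow> (\<sigma> has_real_derivative inverse (f' (\<sigma> r))) (at r)"
    "\<forall>\<^sub>F s in nhds t. f s \<in> J \<and> \<sigma> (f s) = s"
proof -
  have "\<forall>\<^sub>F s in at t. f' s > 0"
    using cont pos by (simp add: isCont_def order_tendstoD(1))
  then obtain d where d: "d > 0" "\<And>s. s \<noteq> t \<Longrightarrow> dist s t < d \<Longrightarrow> f' s > 0"
    unfolding eventually_at by auto
  \<comment> \<open>Half the radius keeps the derivative positive on the closed interval, endpoints
    included.\<close>
  define a b where "a = t - d / 2" and "b = t + d / 2"
  have ab: "a < t" "t < b" using d by (auto simp: a_def b_def)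
  have pos: "f' s > 0" if "a \<le> s" "s \<le> b" for s
    using d(1) d(2)[of s] pos that by (cases "s = t") (auto simp: a_def b_def dist_real_def)
  have mono: "f x < f y" if "a \<le> x" "x < y" "y \<le> b" for x y
    by (rule DERIV_pos_imp_increasing[OF that(2)]) (meson der pos order_trans that)
  have cont_f: "isCont f s" for s by (rule DERIV_isCont[OF der])
  define \<sigma> where "\<sigma> = the_inv_into {a..b} f"
  have "inj_on f {a..b}"
    by (rule linorder_inj_onI) (use mono in \<open>force+\<close>)
  then have \<sigma>f: "\<sigma> (f s) = s" if "a \<le> s" "s \<le> b" for s
    using that unfolding \<sigma>_def by (simp add: the_inv_into_f_f)
  have surj: "\<exists>s. a < s \<and> s < b \<and> f s = r" if "f a < r" "r < f b" for r
  proof -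
    have "\<exists>s\<ge>a. s \<le> b \<and> f s = r"
      using IVT[of f a r b] that cont_f ab by auto
    then obtain s where "a \<le> s" "s \<le> b" "f s = r" by blast
    then show ?thesis using that by (metis less_le order_less_irrefl)
  qed
  have deriv: "(\<sigma> has_real_derivative inverse (f' (\<sigma> r))) (at r) \<and> f' (\<sigma> r) > 0"
    if r: "r \<in> {f a<..<f b}" for r
  proof -
    obtain s where s: "a < s" "s < b" "f s = r" using surj r by auto
    have "isCont \<sigma> (f s)"
      by (rule isCont_inverse_function2[OF s(1,2)]) (auto simp: \<sigma>f cont_f)
    then have "DERIV \<sigma> r :> inverse (f' (\<sigma> r))"
    proof (intro DERIV_inverse_function[where f = f and a = "f a" and b = "f b"])
      show "f' (\<sigma> r) \<noteq> 0" using pos[of s] s \<sigma>f[of s] by auto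
      show "f (\<sigma> y) = y" if "f a < y" "y < f b" for y
        using surj[OF that] \<sigma>f by auto
    qed (use r s der in auto)
    moreover have "f' (\<sigma> r) > 0" using pos[of s] s \<sigma>f[of s] by auto
    ultimately show ?thesis by simp
  qed
  have "\<forall>\<^sub>F s in nhds t. s \<in> {a<..<b}"
    using ab by (intro eventually_nhds_in_open) auto
  then have "\<forall>\<^sub>F s in nhds t. f s \<in> {f a<..<f b} \<and> \<sigma> (f s) = s"
    by eventually_elim (use mono \<sigma>f in auto)
  then show ?thesis using that[of "{f a<..<f b}" \<sigma>] deriv by auto
qed

context normal_extremal
begin

lemma \<gamma>'_nonzero: "hh 1 t *\<^sub>R X 1 (\<gamma> t) + hh 2 t *\<^sub>R X 2 (\<gamma> t) \<noteq> 0"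
proof
  assume *: "hh 1 t *\<^sub>R X 1 (\<gamma> t) + hh 2 t *\<^sub>R X 2 (\<gamma> t) = 0"
  have "hh k t = 0" if "k \<in> {1, 2}" for k
    using arg_cong[OF *, of "\<lambda>v. \<omega> k (\<gamma> t) \<bullet> v"] that dual[of k 1] dual[of k 2]
    by (auto simp: inner_add_right)
  then show False using unit[of t] by simp
qed

lemma fst_Hvec: "fst (Hvec (\<phi> t)) = hh 1 t *\<^sub>R X 1 (\<gamma> t) + hh 2 t *\<^sub>R X 2 (\<gamma> t)"
  by (simp add: hvec_def \<gamma>_def)

lemma continuous_\<phi>: "isCont \<phi> t"
  using \<phi>' has_vector_derivative_continuous by blast

text \<open>Parametrizing \<open>\<phi>\<close> by a linear function of the base point that increases along \<open>\<gamma>\<close>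
  keeps it an integral curve of a smooth field, so the controls become smooth functions of
  the base point.\<close>

lemma controls_extend:
  obtains U v1 v2 where "open U" "\<gamma> t \<in> U" "smooth_on U v1" "smooth_on U v2"
    "\<forall>\<^sub>F s in nhds t. v1 (\<gamma> s) = hh 1 s \<and> v2 (\<gamma> s) = hh 2 s"
proof -
  \<comment> \<open>With the velocity at \<open>t\<close> itself as the linear function, its growth
    rate along the curve at \<open>t\<close> is the squared norm of the velocity, hence
    positive.\<close>
  define l where "l = fst (Hvec (\<phi> t))"
  have "l \<noteq> 0" using \<gamma>'_nonzero[of t] unfolding l_def fst_Hvec .
  define D where "D z = l \<bullet> fst (Hvec z)" for z
  have D_smooth: "C_diff_on k UNIV D" for k
    unfolding D_def[abs_def]
    by (intro C_diff_on_inner C_diff_on_const C_diff_on_bounded_linear[OF bounded_linear_fst]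
        C_diff_on_Hvec open_UNIV)
  have D_cont: "continuous_on UNIV D" using D_smooth[of 0] by simp
  define f where "f s = l \<bullet> \<gamma> s" for s
  have f': "(f has_real_derivative D (\<phi> s)) (at s)" for s
    unfolding f_def[abs_def] has_real_derivative_iff_has_vector_derivative D_def fst_Hvec
    by (rule bounded_linear.has_vector_derivative[OF bounded_linear_inner_right \<gamma>_derivative])
  have "isCont D (\<phi> t)"
    using D_cont continuous_on_eq_continuous_at[OF open_UNIV] by blast
  then have "isCont (\<lambda>s. D (\<phi> s)) t"
    by (rule isCont_o2[OF continuous_\<phi>])
  moreover have "D (\<phi> t) > 0" using \<open>l \<noteq> 0\<close> by (simp add: D_def l_def)
  ultimately obtain J \<sigma> where J: "open J" "\<And>r. r \<in> J \<Longrightarrow> D (\<phi> (\<sigma> r)) > 0"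
    "\<And>r. r \<in> J \<Longrightarrow> (\<sigma> has_real_derivative inverse (D (\<phi> (\<sigma> r)))) (at r)"
    "\<forall>\<^sub>F s in nhds t. f s \<in> J \<and> \<sigma> (f s) = s"
    using local_inverse_real[of f "\<lambda>s. D (\<phi> s)" t, OF f'] by blast
  define Z where "Z r = \<phi> (\<sigma> r)" for r
  define V where "V = {z. D z \<noteq> 0}"
  have "open V" unfolding V_def using D_cont by (intro open_Collect_neq) auto
  have "C_diff_on k V (\<lambda>z. inverse (D z) *\<^sub>R Hvec z)" for k
    by (intro C_diff_on_scaleR C_diff_on_inverse \<open>open V\<close> C_diff_on_subset[OF D_smooth]
        C_diff_on_subset[OF C_diff_on_Hvec]) (simp_all add: V_def)
  moreover have "(Z has_vector_derivative inverse (D (Z r)) *\<^sub>R Hvec (Z r)) (at r)" if "r \<in> J" for r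
    using vector_diff_chain_at[OF J(3)[OF that, unfolded has_real_derivative_iff_has_vector_derivative] \<phi>']
    by (simp add: Z_def[abs_def] o_def)
  moreover have "Z ` J \<subseteq> V" using J(2) by (fastforce simp: V_def Z_def)
  ultimately have Z_smooth: "C_diff_on k J Z" for k
    by (intro C_diff_on_integral_curve[OF J(1) \<open>open V\<close>]) 
  define U where "U = (\<lambda>x. l \<bullet> x) -` J"
  \<comment> \<open>The extended momenta are constant on the hyperplanes orthogonal to
    \<open>l\<close>; at \<open>\<gamma> s\<close> with \<open>s\<close> near \<open>t\<close>,
    \<open>\<sigma>\<close> returns \<open>s\<close>.\<close>
  define v where "v i x = h X i (Z (l \<bullet> x))" for i x
  have "open U" unfolding U_def
    by (rule open_vimage[OF J(1)]) (intro continuous_intros)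
  have v_smooth: "smooth_on U (v i)" if "i \<in> {1..5}" for i
    unfolding smooth_on_def v_def
  proof
    fix k
    have "C_diff_on k U (\<lambda>x. Z (l \<bullet> x))"
      by (rule C_diff_on_compose[OF \<open>open U\<close> J(1) _ Z_smooth C_diff_on_linear[OF bounded_linear_inner_right \<open>open U\<close>]])
         (auto simp: U_def)
    from C_diff_on_compose[OF \<open>open U\<close> open_UNIV subset_UNIV C_diff_on_h[OF that] this]
    show "C_diff_on k U (\<lambda>x. h X i (Z (l \<bullet> x)))" .
  qed
  have "\<gamma> t \<in> U" using eventually_nhds_x_imp_x[OF J(4)] by (simp add: U_def f_def)
  moreover have "\<forall>\<^sub>F s in nhds t. v 1 (\<gamma> s) = hh 1 s \<and> v 2 (\<gamma> s) = hh 2 s"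
    using J(4) by eventually_elim (simp add: v_def Z_def f_def)
  ultimately show ?thesis using that[of U "v 1" "v 2"] \<open>open U\<close> v_smooth by auto
qed

end

(* keeps the index 1 in X 1 and hh 1 from being rewritten to Suc 0 *)
declare One_nat_def [simp del]

section \<open>Smooth maps as vector fields\<close>

lemma smooth_on_differentiable: "smooth_on U V \<Longrightarrow> x \<in> U \<Longrightarrow> V differentiable (at x)"
  unfolding smooth_on_def using C_diff_on.simps(2) by blast

lemma smooth_on_lie_bracket:
  assumes "open U" "smooth_on U V" "smooth_on U W"
  shows "smooth_on U (lie_bracket V W)"
  using assms unfolding smooth_on_def lie_bracket_def
  by (intro allI C_diff_on_diff C_diff_on_frechet_derivative) blast+

lemma smooth_on_iterated_bracket:
  assumes "open U" "smooth_on U T" "smooth_on U Y"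
  shows "smooth_on U ((lie_bracket T ^^ j) Y)"
  by (induction j) (simp_all add: assms smooth_on_lie_bracket)

lemma smooth_on_scaleR: "open U \<Longrightarrow> smooth_on U f \<Longrightarrow> smooth_on U V \<Longrightarrow> smooth_on U (\<lambda>x. f x *\<^sub>R V x)"
  unfolding smooth_on_def by (blast intro: C_diff_on_scaleR)

lemma smooth_on_add: "open U \<Longrightarrow> smooth_on U V \<Longrightarrow> smooth_on U W \<Longrightarrow> smooth_on U (\<lambda>x. V x + W x)"
  unfolding smooth_on_def by (blast intro: C_diff_on_add)

lemma smooth_on_minus: "open U \<Longrightarrow> smooth_on U V \<Longrightarrow> smooth_on U (\<lambda>x. - V x)"
  unfolding smooth_on_def by (blast intro: C_diff_on_minus)

section \<open>Coefficients of the iterated brackets along an extremal\<close>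

text \<open>One admissible pair \<open>T\<close>, \<open>Y\<close>, together with an open set
  \<open>N\<close> of times, so that identities along the curve can be differentiated in
  time.\<close>

locale flag_section = normal_extremal +
  fixes N :: "real set" and U :: "(real^5) set" and T Y :: field5
  assumes open_U: "open U" and open_N: "open N"
    and horizontal_T: "horizontal_on X U T" and horizontal_Y: "horizontal_on X U Y"
    and in_U: "\<And>s. s \<in> N \<Longrightarrow> \<gamma> s \<in> U"
    and T_\<gamma>: "\<And>s. s \<in> N \<Longrightarrow> T (\<gamma> s) = hh 1 s *\<^sub>R X 1 (\<gamma> s) + hh 2 s *\<^sub>R X 2 (\<gamma> s)"
begin

definition w :: "nat \<Rightarrow> nat \<Rightarrow> real \<Rightarrow> real" where
  "w j k s = \<omega> k (\<gamma> s) \<bullet> (lie_bracket T ^^ j) Y (\<gamma> s)"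

lemma w_0: "s \<in> N \<Longrightarrow> k \<in> {3..5} \<Longrightarrow> w 0 k s = 0"
  using horizontal_coframe horizontal_Y in_U by (simp add: w_def horizontal_on_def)

text \<open>On the curve \<open>T\<close> is the velocity, so the time derivative of a coefficient
  is its derivative along \<open>T\<close>; \<open>coframe_lie_bracket\<close> expresses this
  through the next bracket.\<close>

lemma w_derivative:
  assumes s: "s \<in> N" and k: "k \<in> {3..5}"
  shows "(w j k has_real_derivative w (Suc j) k s
    - (\<Sum>i\<in>{1..5}. w j i s * (hh 1 s * (\<omega> k (\<gamma> s) \<bullet> lie_bracket (X 1) (X i) (\<gamma> s))
      + hh 2 s * (\<omega> k (\<gamma> s) \<bullet> lie_bracket (X 2) (X i) (\<gamma> s))))) (at s)"
proof -
  let ?W = "(lie_bracket T ^^ j) Y" and ?x = "\<gamma> s"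
  have k5: "k \<in> {1..5}" using k by auto
  have W: "?W differentiable (at ?x)" and T: "T differentiable (at ?x)"
    using smooth_on_iterated_bracket[OF open_U, of T Y j] horizontal_T horizontal_Y in_U[OF s]
    by (auto simp: horizontal_on_def smooth_on_differentiable)
  have u: "\<omega> 1 ?x \<bullet> T ?x = hh 1 s" "\<omega> 2 ?x \<bullet> T ?x = hh 2 s"
    using T_\<gamma>[OF s] dual[of 1 1 ?x] dual[of 1 2 ?x] dual[of 2 1 ?x] dual[of 2 2 ?x]
    by (simp_all add: inner_add_right)
  have "(\<lambda>y. \<omega> k y \<bullet> ?W y) differentiable (at ?x)"
    using differentiable_inner[OF coframe_differentiable[OF k5] W] .
  then have "((\<lambda>y. \<omega> k y \<bullet> ?W y) has_derivative frechet_derivative (\<lambda>y. \<omega> k y \<bullet> ?W y) (at ?x)) (at ?x)"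
    by (simp add: frechet_derivative_works)
  note chain = vector_derivative_diff_chain_within[OF \<gamma>_derivative has_derivative_at_withinI[OF this]]
  have "(w j k has_real_derivative frechet_derivative (\<lambda>y. \<omega> k y \<bullet> ?W y) (at ?x) (T ?x)) (at s)"
    using chain
    by (simp add: w_def[abs_def] o_def has_real_derivative_iff_has_vector_derivative T_\<gamma>[OF s])
  moreover have "w (Suc j) k s = \<omega> k ?x \<bullet> lie_bracket T ?W ?x" by (simp add: w_def)
  moreover have "\<And>y. y \<in> U \<Longrightarrow> T y \<in> span {X 1 y, X 2 y}"
    using horizontal_T by (simp add: horizontal_on_def)
  ultimately show ?thesis
    using coframe_lie_bracket[OF open_U in_U[OF s] _ T W k] by (simp add: u w_def del: One_nat_def)
qed

lemma w_derivatives: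
  assumes "s \<in> N"
  shows "(w j 3 has_real_derivative w (Suc j) 3 s - (hh 1 s * w j 2 s - hh 2 s * w j 1 s)) (at s)"
    and "(w j 4 has_real_derivative w (Suc j) 4 s - hh 1 s * w j 3 s) (at s)"
    and "(w j 5 has_real_derivative w (Suc j) 5 s - hh 2 s * w j 3 s) (at s)"
proof -
  have d: "\<omega> k x \<bullet> X i x = (if i = k then 1 else 0)" if "k \<in> {3, 4, 5}" "i \<in> {1, 2, 3, 4, 5}" for k i x
    using dual[of k i x] that by auto
  note d' = d[of 3 3] d[of 3 4] d[of 3 5] d[of 4 3] d[of 4 4] d[of 4 5] d[of 5 3] d[of 5 4] d[of 5 5]
  show "(w j 3 has_real_derivative w (Suc j) 3 s - (hh 1 s * w j 2 s - hh 2 s * w j 1 s)) (at s)"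
    using w_derivative[OF assms, of 3 j] unfolding atLeastAtMost_1_5 by (simp add: brackets_12[simplified] d' algebra_simps)
  show "(w j 4 has_real_derivative w (Suc j) 4 s - hh 1 s * w j 3 s) (at s)"
    using w_derivative[OF assms, of 4 j] unfolding atLeastAtMost_1_5 by (simp add: brackets_12[simplified] d' algebra_simps)
  show "(w j 5 has_real_derivative w (Suc j) 5 s - hh 2 s * w j 3 s) (at s)"
    using w_derivative[OF assms, of 5 j] unfolding atLeastAtMost_1_5 by (simp add: brackets_12[simplified] d' algebra_simps)
qed

lemma derivative_eqI:
  assumes "\<And>s. s \<in> N \<Longrightarrow> f s = g s" "s \<in> N"
    "(f has_real_derivative f') (at s)" "(g has_real_derivative g') (at s)"
  shows "f' = g'"
  using assms has_field_derivative_transform_within_open[OF _ open_N] DERIV_unique by metis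

text \<open>The coefficients in \<open>w_0\<close> vanish identically on \<open>N\<close>, hence so
  do their derivatives, and \<open>w_derivatives\<close> can be solved for the next level. The same
  pattern yields \<open>w_2\<close> and \<open>\<kappa>_3\<close>.\<close>

lemma w_1: "s \<in> N \<Longrightarrow> w 1 4 s = 0" "s \<in> N \<Longrightarrow> w 1 5 s = 0"
  "s \<in> N \<Longrightarrow> w 1 3 s = hh 1 s * w 0 2 s - hh 2 s * w 0 1 s"
proof -
  have *: "f' = 0" if "k \<in> {3..5}" "s \<in> N" "(w 0 k has_real_derivative f') (at s)" for k f' s
    using derivative_eqI[OF w_0[OF _ that(1)] that(2,3) DERIV_const] .
  show "w 1 4 s = 0" if "s \<in> N"
    using *[OF _ that w_derivatives(2)[OF that]] w_0[OF that] by (simp add: One_nat_def)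
  show "w 1 5 s = 0" if "s \<in> N"
    using *[OF _ that w_derivatives(3)[OF that]] w_0[OF that] by (simp add: One_nat_def)
  show "w 1 3 s = hh 1 s * w 0 2 s - hh 2 s * w 0 1 s" if "s \<in> N"
    using *[OF _ that w_derivatives(1)[OF that]] by (simp add: One_nat_def)
qed

lemma w_2:
  assumes "s \<in> N" shows "w 2 4 s = hh 1 s * w 1 3 s" "w 2 5 s = hh 2 s * w 1 3 s"
  using derivative_eqI[OF w_1(1) assms w_derivatives(2)[OF assms] DERIV_const]
    derivative_eqI[OF w_1(2) assms w_derivatives(3)[OF assms] DERIV_const]
  by (simp_all add: Suc_1)

text \<open>In the plane of \<open>X 4\<close> and \<open>X 5\<close>, the component perpendicular
  to the coordinate vector (h_1, h_2); it measures what the bracket adds beyond h_1 X_4 + h_2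
  X_5.\<close>

definition \<kappa> :: "nat \<Rightarrow> real \<Rightarrow> real" where
  "\<kappa> j s = hh 1 s * w j 5 s - hh 2 s * w j 4 s"

lemma \<kappa>_le_2: "s \<in> N \<Longrightarrow> j \<le> 2 \<Longrightarrow> \<kappa> j s = 0"
proof -
  assume s: "s \<in> N" and "j \<le> 2"
  then consider "j = 0" | "j = 1" | "j = 2" by linarith
  then show ?thesis
    by cases (use w_0[OF s] w_1[OF s] w_2[OF s] in \<open>simp_all add: \<kappa>_def\<close>)
qed

text \<open>Differentiating \<open>w_2\<close> turns the direction (h_1, h_2) at rate h_3. The terms
  in \<open>f'\<close> and \<open>w 2 3\<close> are parallel to (h_1, h_2) and cancel in
  \<open>\<kappa>\<close>.\<close>

lemma \<kappa>_3: "s \<in> N \<Longrightarrow> \<kappa> 3 s = hh 3 s * w 1 3 s"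
proof -
  assume s: "s \<in> N"
  define f' where "f' = w 2 3 s - (hh 1 s * w 1 2 s - hh 2 s * w 1 1 s)"
  have f': "(w 1 3 has_real_derivative f') (at s)"
    using w_derivatives(1)[OF s, of 1] by (simp add: f'_def Suc_1)
  have 4: "w 3 4 s - hh 1 s * w 2 3 s = - hh 2 s * hh 3 s * w 1 3 s + f' * hh 1 s"
    by (rule derivative_eqI[OF w_2(1) s _ DERIV_mult[OF hh_derivatives(1) f']])
       (use w_derivatives(2)[OF s, of 2] in \<open>auto simp: numeral_3_eq_3\<close>)
  have 5: "w 3 5 s - hh 2 s * w 2 3 s = hh 1 s * hh 3 s * w 1 3 s + f' * hh 2 s"
    by (rule derivative_eqI[OF w_2(2) s _ DERIV_mult[OF hh_derivatives(2) f']])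
       (use w_derivatives(3)[OF s, of 2] in \<open>auto simp: numeral_3_eq_3\<close>)
  have "\<kappa> 3 s = hh 3 s * w 1 3 s * ((hh 1 s)\<^sup>2 + (hh 2 s)\<^sup>2)"
    using 4 5 unfolding \<kappa>_def by algebra
  then show ?thesis by (simp add: unit)
qed

text \<open>With constant controls the \<open>X 3\<close> terms cancel and the derivative of
  \<open>\<kappa> j\<close> is exactly \<open>\<kappa> (Suc j)\<close>, so vanishing propagates from
  level 0.\<close>

lemma \<kappa>_straight:
  assumes "\<And>s. hh 3 s = 0" and "s \<in> N"
  shows "\<kappa> j s = 0"
  using assms(2)
proof (induction j arbitrary: s)
  case 0
  then show ?case by (simp add: \<kappa>_le_2)
next
  case (Suc j)
  have u: "(hh 1 has_real_derivative 0) (at s)" "(hh 2 has_real_derivative 0) (at s)"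
    using hh_derivatives(1,2)[of s] assms(1) by simp_all
  have "(\<kappa> j has_real_derivative \<kappa> (Suc j) s) (at s)"
    unfolding \<kappa>_def[abs_def]
    by (rule derivative_eq_intros u w_derivatives(2,3) Suc.prems refl)+ (simp add: algebra_simps)
  from derivative_eqI[OF Suc.IH Suc.prems this DERIV_const] show ?case by simp
qed

end

section \<open>The flag along an extremal\<close>

lemma dim_insert_functional:
  fixes a :: "'a::euclidean_space"
  assumes "\<And>v. v \<in> S \<Longrightarrow> p \<bullet> v = 0" "p \<bullet> a \<noteq> 0"
  shows "dim (insert a S) = Suc (dim S)"
proof -
  have "a \<notin> span S"
  proof
    assume "a \<in> span S"
    then have "p \<bullet> a = 0"
      by (induction rule: span_induct) (auto simp: assms(1) subspace_hyperplane)
    with assms(2) show False ..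
  qed
  then show ?thesis by (simp add: dim_insert)
qed

context normal_extremal
begin

text \<open>Continuity keeps the curve in \<open>U\<close> for nearby times, and uniqueness of
  derivatives identifies \<open>T\<close> with the velocity there.\<close>

lemma flag_section_exists:
  assumes "velocity_extension X \<gamma> t U T" "horizontal_on X U Y"
  obtains N where "t \<in> N" "flag_section X \<omega> \<phi> \<gamma> N U T Y"
proof -
  have U: "open U" "\<gamma> t \<in> U" "horizontal_on X U T"
    using assms(1) by (simp_all add: velocity_extension_def)
  have "isCont \<gamma> t"
    using \<gamma>_derivative has_vector_derivative_continuous by blast
  then have "\<forall>\<^sub>F s in nhds t. \<gamma> s \<in> U"
    using U(1,2) by (simp add: continuous_at_open eventually_nhds)
  moreover have "\<forall>\<^sub>F s in nhds t. (\<gamma> has_vector_derivative T (\<gamma> s)) (at s)"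
    using assms(1) by (simp add: velocity_extension_def)
  ultimately have "\<forall>\<^sub>F s in nhds t. \<gamma> s \<in> U \<and> T (\<gamma> s) = hh 1 s *\<^sub>R X 1 (\<gamma> s) + hh 2 s *\<^sub>R X 2 (\<gamma> s)"
    by eventually_elim (blast intro: vector_derivative_unique_at[OF _ \<gamma>_derivative])
  then obtain N where N: "open N" "t \<in> N"
    "\<And>s. s \<in> N \<Longrightarrow> \<gamma> s \<in> U \<and> T (\<gamma> s) = hh 1 s *\<^sub>R X 1 (\<gamma> s) + hh 2 s *\<^sub>R X 2 (\<gamma> s)"
    unfolding eventually_nhds by blast
  show ?thesis
    by (rule that[OF N(2)], unfold_locales) (use N U assms(2) in auto)
qed

text \<open>The form in which every upper bound is proved: each bracket of each section is placed in
  a fixed subspace.\<close>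

lemma flag_subset:
  assumes "subspace V"
    and "\<And>T Y U N j. flag_section X \<omega> \<phi> \<gamma> N U T Y \<Longrightarrow> t \<in> N \<Longrightarrow> j \<le> i - 1 \<Longrightarrow>
      (lie_bracket T ^^ j) Y (\<gamma> t) \<in> V"
  shows "flag X \<gamma> i t \<subseteq> V"
  unfolding flag_def
proof (rule span_minimal[OF _ assms(1)])
  show "{(lie_bracket T ^^ j) Y (\<gamma> t) | T Y U j.
     velocity_extension X \<gamma> t U T \<and> horizontal_on X U Y \<and> j \<le> i - 1} \<subseteq> V"
  proof clarify
    fix T Y U j
    assume T: "velocity_extension X \<gamma> t U T" and Y: "horizontal_on X U Y" and j: "j \<le> i - 1"
    obtain N where "t \<in> N" "flag_section X \<omega> \<phi> \<gamma> N U T Y"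
      using flag_section_exists[OF T Y] .
    then show "(lie_bracket T ^^ j) Y (\<gamma> t) \<in> V" using assms(2) j by blast
  qed
qed

lemma smooth_on_X: "i \<in> {1..5} \<Longrightarrow> smooth_on U (X i)"
  by (simp add: smooth_on_def X_C_diff)

text \<open>The section \<open>Y\<close> is the velocity rotated by a right angle, so that the \<open>X 3\<close>
  coefficient of \<open>[T,Y]\<close> along \<open>\<gamma>\<close> is 1.\<close>

lemma rotated_section:
  obtains N U T Y where "velocity_extension X \<gamma> t U T" "t \<in> N" "flag_section X \<omega> \<phi> \<gamma> N U T Y"
    "flag_section.w \<omega> \<gamma> T Y 1 3 t = 1"
proof -
  obtain U v1 v2 where U: "open U" "\<gamma> t \<in> U" "smooth_on U v1" "smooth_on U v2"
    and v: "\<forall>\<^sub>F s in nhds t. v1 (\<gamma> s) = hh 1 s \<and> v2 (\<gamma> s) = hh 2 s"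
    using controls_extend .
  define T Y where "T x = v1 x *\<^sub>R X 1 x + v2 x *\<^sub>R X 2 x"
    and "Y x = (- v2 x) *\<^sub>R X 1 x + v1 x *\<^sub>R X 2 x" for x
  have span: "a *\<^sub>R X 1 x + b *\<^sub>R X 2 x \<in> span {X 1 x, X 2 x}" for a b x
    by (intro span_add span_scale span_base) auto
  have T: "horizontal_on X U T" and Y: "horizontal_on X U Y"
    unfolding horizontal_on_def T_def[abs_def] Y_def[abs_def]
    by (intro conjI ballI span smooth_on_add smooth_on_scaleR smooth_on_minus smooth_on_X U; simp)+
  have "\<forall>\<^sub>F s in nhds t. (\<gamma> has_vector_derivative T (\<gamma> s)) (at s)"
    using v by eventually_elim (simp only: T_def \<gamma>_derivative)
  then have ext: "velocity_extension X \<gamma> t U T"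
    using U T by (simp add: velocity_extension_def)
  obtain N where N: "t \<in> N" "flag_section X \<omega> \<phi> \<gamma> N U T Y"
    using flag_section_exists[OF ext Y] .
  interpret flag_section X \<omega> \<phi> \<gamma> N U T Y by (rule N(2))
  have vt: "v1 (\<gamma> t) = hh 1 t" "v2 (\<gamma> t) = hh 2 t"
    using eventually_nhds_x_imp_x[OF v] by auto
  have "w 0 1 t = - hh 2 t" "w 0 2 t = hh 1 t"
    unfolding w_def using dual[of 1 1 "\<gamma> t"] dual[of 1 2 "\<gamma> t"] dual[of 2 1 "\<gamma> t"] dual[of 2 2 "\<gamma> t"]
    by (simp_all add: Y_def vt inner_add_right inner_diff_right)
  then have "w 1 3 t = 1"
    using w_1(3)[OF N(1)] unit[of t] by (simp add: power2_eq_square)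
  then show ?thesis using that ext N by blast
qed

abbreviation A :: "real \<Rightarrow> real^5" where
  "A t \<equiv> hh 1 t *\<^sub>R X 4 (\<gamma> t) + hh 2 t *\<^sub>R X 5 (\<gamma> t)"

text \<open>It serves twice: pairing with it gives \<open>\<kappa>\<close>, which bounds the flag,
  and it is the momentum of the abnormal lift.\<close>

definition annihilator :: "real \<Rightarrow> real^5" where
  "annihilator t = hh 1 t *\<^sub>R \<omega> 5 (\<gamma> t) - hh 2 t *\<^sub>R \<omega> 4 (\<gamma> t)"

lemma annihilator_X:
  "annihilator t \<bullet> X 1 (\<gamma> t) = 0" "annihilator t \<bullet> X 2 (\<gamma> t) = 0" "annihilator t \<bullet> X 3 (\<gamma> t) = 0"
  "annihilator t \<bullet> X 4 (\<gamma> t) = - hh 2 t" "annihilator t \<bullet> X 5 (\<gamma> t) = hh 1 t"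
  using dual[of 4 _ "\<gamma> t"] dual[of 5 _ "\<gamma> t"] 
  by (simp_all add: annihilator_def inner_diff_left)

lemma annihilator_nonzero: "annihilator t \<noteq> 0"
proof
  assume "annihilator t = 0"
  then show False using annihilator_X(4,5)[of t] unit[of t] by simp
qed

lemma (in flag_section) annihilator_bracket:
  "annihilator s \<bullet> (lie_bracket T ^^ j) Y (\<gamma> s) = \<kappa> j s"
  by (simp add: annihilator_def \<kappa>_def w_def inner_diff_left)

section \<open>Upper bounds for the flag\<close>

lemma flag_subset_1: "flag X \<gamma> 1 t \<subseteq> span {X 1 (\<gamma> t), X 2 (\<gamma> t)}"
proof (rule flag_subset)
  fix T Y U N j assume "flag_section X \<omega> \<phi> \<gamma> N U T Y" "t \<in> N" "j \<le> 1 - (1::nat)"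
  then interpret flag_section X \<omega> \<phi> \<gamma> N U T Y by simp
  show "(lie_bracket T ^^ j) Y (\<gamma> t) \<in> span {X 1 (\<gamma> t), X 2 (\<gamma> t)}"
    using \<open>j \<le> _\<close> horizontal_Y in_U[OF \<open>t \<in> N\<close>] by (simp add: horizontal_on_def)
qed simp

lemma flag_subset_2: "flag X \<gamma> 2 t \<subseteq> span {X 1 (\<gamma> t), X 2 (\<gamma> t), X 3 (\<gamma> t)}"
proof (rule flag_subset)
  fix T Y U N j assume asm: "flag_section X \<omega> \<phi> \<gamma> N U T Y" "t \<in> N" "j \<le> 2 - (1::nat)"
  interpret flag_section X \<omega> \<phi> \<gamma> N U T Y by (rule asm(1))
  let ?v = "(lie_bracket T ^^ j) Y (\<gamma> t)"
  have "j = 0 \<or> j = 1" using asm(3) by linarith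
  then have "w j 4 t = 0" "w j 5 t = 0"
    using w_0[OF asm(2)] w_1[OF asm(2)] by auto
  then have "?v = w j 1 t *\<^sub>R X 1 (\<gamma> t) + w j 2 t *\<^sub>R X 2 (\<gamma> t) + w j 3 t *\<^sub>R X 3 (\<gamma> t)"
    using expand5[of ?v "\<gamma> t"] by (simp add: w_def)
  then show "?v \<in> span {X 1 (\<gamma> t), X 2 (\<gamma> t), X 3 (\<gamma> t)}"
    by (simp only:) (intro span_add span_scale span_base; simp)
qed simp

lemma flag_subset_3: "flag X \<gamma> 3 t \<subseteq> span {X 1 (\<gamma> t), X 2 (\<gamma> t), X 3 (\<gamma> t), A t}"
proof (rule flag_subset)
  fix T Y U N j assume asm: "flag_section X \<omega> \<phi> \<gamma> N U T Y" "t \<in> N" "j \<le> 3 - (1::nat)"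
  interpret flag_section X \<omega> \<phi> \<gamma> N U T Y by (rule asm(1))
  let ?v = "(lie_bracket T ^^ j) Y (\<gamma> t)"
  \<comment> \<open>The component along the unit vector (h_1, h_2); since the perpendicular
    component \<open>\<kappa>\<close> is zero, \<open>e\<close> determines both
    coefficients.\<close>
  define e where "e = hh 1 t * w j 4 t + hh 2 t * w j 5 t"
  have "\<kappa> j t = 0" using \<kappa>_le_2[OF asm(2)] asm(3) by simp
  then have "w j 4 t = e * hh 1 t" "w j 5 t = e * hh 2 t"
    using unit[of t] unfolding e_def \<kappa>_def by algebra+
  then have "?v = w j 1 t *\<^sub>R X 1 (\<gamma> t) + w j 2 t *\<^sub>R X 2 (\<gamma> t) + w j 3 t *\<^sub>R X 3 (\<gamma> t) + e *\<^sub>R A t"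
    using expand5[of ?v "\<gamma> t"] by (simp add: w_def scaleR_add_right add.assoc)
  then show "?v \<in> span {X 1 (\<gamma> t), X 2 (\<gamma> t), X 3 (\<gamma> t), A t}"
    by (simp only:) (intro span_add[OF span_add[OF span_add]] span_scale span_base; simp)
qed simp

lemma flag_subset_annihilator:
  assumes "hh 3 t = 0" shows "flag X \<gamma> 4 t \<subseteq> {v. annihilator t \<bullet> v = 0}"
proof (rule flag_subset)
  fix T Y U N j assume asm: "flag_section X \<omega> \<phi> \<gamma> N U T Y" "t \<in> N" "j \<le> 4 - (1::nat)"
  interpret flag_section X \<omega> \<phi> \<gamma> N U T Y by (rule asm(1))
  have "j \<le> 2 \<or> j = 3" using asm(3) by linarith
  then have "\<kappa> j t = 0" using \<kappa>_le_2[OF asm(2)] \<kappa>_3[OF asm(2)] assms by auto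
  then show "(lie_bracket T ^^ j) Y (\<gamma> t) \<in> {v. annihilator t \<bullet> v = 0}"
    by (simp add: annihilator_bracket)
qed (simp add: subspace_hyperplane)

lemma flag_subset_annihilator_straight:
  assumes "\<And>s. hh 3 s = 0" shows "flag X \<gamma> i t \<subseteq> {v. annihilator t \<bullet> v = 0}"
proof (rule flag_subset)
  fix T Y U N j assume asm: "flag_section X \<omega> \<phi> \<gamma> N U T Y" "t \<in> N" "j \<le> i - (1::nat)"
  interpret flag_section X \<omega> \<phi> \<gamma> N U T Y by (rule asm(1))
  show "(lie_bracket T ^^ j) Y (\<gamma> t) \<in> {v. annihilator t \<bullet> v = 0}"
    using \<kappa>_straight[OF assms asm(2)] by (simp add: annihilator_bracket)
qed (simp add: subspace_hyperplane)

section \<open>Lower bounds and the growth vector\<close>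

lemma subspace_flag: "subspace (flag X \<gamma> i t)"
  by (simp add: flag_def)

lemma flag_base:
  "velocity_extension X \<gamma> t U T \<Longrightarrow> horizontal_on X U Y \<Longrightarrow> j \<le> i - 1 \<Longrightarrow>
    (lie_bracket T ^^ j) Y (\<gamma> t) \<in> flag X \<gamma> i t"
  unfolding flag_def by (rule span_base) blast

text \<open>Elimination on the brackets of the rotated section, whose \<open>w 1 3\<close> is 1:
  after subtracting members already found, the first bracket leaves \<open>X 3\<close>, the second
  leaves \<open>A t\<close>, and the third a vector independent of \<open>A t\<close> when h_3 is
  nonzero.\<close>

lemma flag_mem:
  shows "X 1 (\<gamma> t) \<in> flag X \<gamma> i t" "X 2 (\<gamma> t) \<in> flag X \<gamma> i t"
    and "2 \<le> i \<Longrightarrow> X 3 (\<gamma> t) \<in> flag X \<gamma> i t"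
    and "3 \<le> i \<Longrightarrow> A t \<in> flag X \<gamma> i t"
    and "4 \<le> i \<Longrightarrow> hh 3 t \<noteq> 0 \<Longrightarrow> flag X \<gamma> i t = UNIV"
proof -
  let ?F = "flag X \<gamma> i t"
  obtain N U T Y where ext: "velocity_extension X \<gamma> t U T" and t: "t \<in> N"
    and sec: "flag_section X \<omega> \<phi> \<gamma> N U T Y" and w13: "flag_section.w \<omega> \<gamma> T Y 1 3 t = 1"
    using rotated_section .
  interpret flag_section X \<omega> \<phi> \<gamma> N U T Y by (rule sec)
  note combine = subspace_add[OF subspace_flag] subspace_diff[OF subspace_flag] subspace_scale[OF subspace_flag]
  have "horizontal_on X U (X k)" if "k \<in> {1, 2}" for k
    using that smooth_on_X[of k U] by (auto simp: horizontal_on_def intro: span_base)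
  from flag_base[OF ext this[of 1], of 0 i] flag_base[OF ext this[of 2], of 0 i]
  show X1: "X 1 (\<gamma> t) \<in> ?F" and X2: "X 2 (\<gamma> t) \<in> ?F" by simp_all
  have L: "w j 1 t *\<^sub>R X 1 (\<gamma> t) + w j 2 t *\<^sub>R X 2 (\<gamma> t) + w j 3 t *\<^sub>R X 3 (\<gamma> t)
    + w j 4 t *\<^sub>R X 4 (\<gamma> t) + w j 5 t *\<^sub>R X 5 (\<gamma> t) \<in> ?F" if "j \<le> i - 1" for j
    using flag_base[OF ext horizontal_Y that] unfolding w_def by (simp only: expand5[symmetric])
  have X3: "X 3 (\<gamma> t) \<in> ?F" if "2 \<le> i"
  proof -
    have "w 1 1 t *\<^sub>R X 1 (\<gamma> t) + w 1 2 t *\<^sub>R X 2 (\<gamma> t) + X 3 (\<gamma> t) \<in> ?F"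
      using L[of 1] that w13 w_1(1,2)[OF t] by simp
    from combine(2)[OF this combine(1)[OF combine(3)[OF X1] combine(3)[OF X2]]]
    show ?thesis by (metis add_diff_cancel_left')
  qed
  then show "2 \<le> i \<Longrightarrow> X 3 (\<gamma> t) \<in> ?F" .
  have L45: "w j 4 t *\<^sub>R X 4 (\<gamma> t) + w j 5 t *\<^sub>R X 5 (\<gamma> t) \<in> ?F" if "j \<le> i - 1" "2 \<le> i" for j
    using combine(2)[OF L[OF that(1)] combine(1)[OF combine(1)[OF combine(3)[OF X1] combine(3)[OF X2]]
        combine(3)[OF X3[OF that(2)]]], of "w j 1 t" "w j 2 t" "w j 3 t"]
    by (simp add: add.assoc)
  have A: "A t \<in> ?F" if "3 \<le> i"
    using L45[of 2] that w_2[OF t] w13 by simp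
  then show "3 \<le> i \<Longrightarrow> A t \<in> ?F" .
  assume i: "4 \<le> i" and c: "hh 3 t \<noteq> 0"
  have \<kappa>: "hh 1 t * w 3 5 t - hh 2 t * w 3 4 t = hh 3 t"
    using \<kappa>_3[OF t] w13 by (simp add: \<kappa>_def)
  \<comment> \<open>The coordinates of \<open>A t\<close> and \<open>B\<close> along
    \<open>X 4\<close> and \<open>X 5\<close> have determinant h_3; the two combinations below are
    Cramer's rule for \<open>X 4\<close> and \<open>X 5\<close>.\<close>
  define B where "B = w 3 4 t *\<^sub>R X 4 (\<gamma> t) + w 3 5 t *\<^sub>R X 5 (\<gamma> t)"
  have "B \<in> ?F" using L45[of 3] i by (simp add: B_def)
  have A': "A t \<in> ?F" using A i by simp
  have "w 3 5 t *\<^sub>R A t - hh 2 t *\<^sub>R B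
    = (hh 1 t * w 3 5 t - hh 2 t * w 3 4 t) *\<^sub>R X 4 (\<gamma> t)"
    by (simp add: B_def algebra_simps)
  then have "hh 3 t *\<^sub>R X 4 (\<gamma> t) \<in> ?F"
    using combine(2)[OF combine(3)[OF A'] combine(3)[OF \<open>B \<in> ?F\<close>]] \<kappa> by metis
  from combine(3)[OF this, of "inverse (hh 3 t)"] have X4: "X 4 (\<gamma> t) \<in> ?F" using c by simp
  have "hh 1 t *\<^sub>R B - w 3 4 t *\<^sub>R A t
    = (hh 1 t * w 3 5 t - hh 2 t * w 3 4 t) *\<^sub>R X 5 (\<gamma> t)"
    by (simp add: B_def algebra_simps)
  then have "hh 3 t *\<^sub>R X 5 (\<gamma> t) \<in> ?F"
    using combine(2)[OF combine(3)[OF \<open>B \<in> ?F\<close>] combine(3)[OF A']] \<kappa> by metis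
  from combine(3)[OF this, of "inverse (hh 3 t)"] have X5: "X 5 (\<gamma> t) \<in> ?F" using c by simp
  have "v \<in> ?F" for v
    by (subst expand5[of v "\<gamma> t"]) (intro combine(1,3) X1 X2 X3 X4 X5; use i in simp)
  then show "?F = UNIV" by blast
qed

lemma flag_eq:
  "flag X \<gamma> 1 t = span {X 1 (\<gamma> t), X 2 (\<gamma> t)}"
  "flag X \<gamma> 2 t = span {X 1 (\<gamma> t), X 2 (\<gamma> t), X 3 (\<gamma> t)}"
  "flag X \<gamma> 3 t = span {X 1 (\<gamma> t), X 2 (\<gamma> t), X 3 (\<gamma> t), A t}"
  by (intro antisym flag_subset_1 flag_subset_2 flag_subset_3 span_minimal subspace_flag;
      simp add: flag_mem)+

lemma dim_flag:
  "dim (flag X \<gamma> 1 t) = 2" "dim (flag X \<gamma> 2 t) = 3" "dim (flag X \<gamma> 3 t) = 4"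
proof -
  let ?x = "\<gamma> t"
  have d: "\<omega> k ?x \<bullet> X i ?x = (if i = k then 1 else 0)" if "k \<in> {1, 2, 3, 4, 5}" "i \<in> {1, 2, 3, 4, 5}" for k i
    using dual[of k i ?x] that by auto
  have "dim {X 1 ?x} = Suc (dim ({} :: (real^5) set))"
    by (rule dim_insert_functional[of _ "\<omega> 1 ?x"]) (use d[of 1 1] in auto)
  moreover have "dim {X 2 ?x, X 1 ?x} = Suc (dim {X 1 ?x})"
    by (rule dim_insert_functional[of _ "\<omega> 2 ?x"]) (use d[of 2 1] d[of 2 2] in auto)
  moreover have "dim {X 3 ?x, X 2 ?x, X 1 ?x} = Suc (dim {X 2 ?x, X 1 ?x})"
    by (rule dim_insert_functional[of _ "\<omega> 3 ?x"]) (use d[of 3 1] d[of 3 2] d[of 3 3] in auto)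
  moreover have "dim {A t, X 3 ?x, X 2 ?x, X 1 ?x} = Suc (dim {X 3 ?x, X 2 ?x, X 1 ?x})"
  \<comment> \<open>This functional kills \<open>X 1\<close>, \<open>X 2\<close>, \<open>X 3\<close>
    and takes the value 1 on \<open>A t\<close> by unit speed.\<close>
  proof (rule dim_insert_functional[of _ "hh 1 t *\<^sub>R \<omega> 4 ?x + hh 2 t *\<^sub>R \<omega> 5 ?x"])
    show "(hh 1 t *\<^sub>R \<omega> 4 ?x + hh 2 t *\<^sub>R \<omega> 5 ?x) \<bullet> A t \<noteq> 0"
      using d[of 4 4] d[of 4 5] d[of 5 4] d[of 5 5] unit[of t]
      by (simp add: inner_add_left inner_add_right power2_eq_square)
  qed (use d[of 4 1] d[of 4 2] d[of 4 3] d[of 5 1] d[of 5 2] d[of 5 3] in \<open>auto simp: inner_add_left\<close>)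
  ultimately show "dim (flag X \<gamma> 1 t) = 2" "dim (flag X \<gamma> 2 t) = 3" "dim (flag X \<gamma> 3 t) = 4"
    by (simp_all add: flag_eq[simplified] insert_commute)
qed

section \<open>Criteria for equiregularity and ampleness\<close>

lemma equiregularI:
  assumes "\<And>s. hh 3 s \<noteq> 0" shows "equiregular_at X \<gamma> t"
proof -
  have "dim (flag X \<gamma> i s) = dim (flag X \<gamma> i t)" if i: "i \<ge> 1" for i s
  proof -
    consider "i = 1" | "i = 2" | "i = 3" | "i \<ge> 4" using i by linarith
    then show ?thesis by cases (simp_all add: dim_flag flag_mem(5) assms)
  qed
  then show ?thesis unfolding equiregular_at_def by (intro always_eventually) blast
qed

text \<open>A locally constant growth vector would carry the full fourth term from nearby times to
  \<open>t\<close>, where \<open>annihilator t\<close> would have to be orthogonal to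
  itself.\<close>

lemma not_equiregularI:
  assumes "hh 3 t = 0" "\<forall>\<^sub>F s in at t. hh 3 s \<noteq> 0" shows "\<not> equiregular_at X \<gamma> t"
proof
  assume "equiregular_at X \<gamma> t"
  then have "\<forall>\<^sub>F s in at t. dim (flag X \<gamma> 4 s) = dim (flag X \<gamma> 4 t)"
    unfolding equiregular_at_def eventually_nhds_conv_at by (auto elim: eventually_mono)
  with assms(2) have "\<forall>\<^sub>F s in at t. hh 3 s \<noteq> 0 \<and> dim (flag X \<gamma> 4 s) = dim (flag X \<gamma> 4 t)"
    by eventually_elim simp
  then obtain s where "hh 3 s \<noteq> 0" "dim (flag X \<gamma> 4 s) = dim (flag X \<gamma> 4 t)"
    using eventually_happens'[OF at_neq_bot] by blast
  then have "dim (flag X \<gamma> 4 t) = DIM(real^5)" using flag_mem(5)[of 4 s] by simp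
  then have "flag X \<gamma> 4 t = UNIV" 
    using dim_eq_full[of "flag X \<gamma> 4 t"] subspace_flag by (simp add: span_eq_iff[THEN iffD2])
  then have "annihilator t \<bullet> annihilator t = 0"
    using flag_subset_annihilator[OF assms(1)] by blast
  then show False using annihilator_nonzero by simp
qed

lemma not_ample_straight:
  assumes "\<And>s. hh 3 s = 0" shows "\<not> ample X \<gamma>"
proof
  assume "ample X \<gamma>"
  then obtain i where "flag X \<gamma> i 0 = UNIV" by (auto simp: ample_def ample_at_def)
  then have "annihilator 0 \<bullet> annihilator 0 = 0"
    using flag_subset_annihilator_straight[OF assms] by blast
  then show False using annihilator_nonzero by simp
qed

end

section \<open>Straight extremals are abnormal\<close>

context normal_extremal
begin

lemma continuous_hvec: "i \<in> {1..5} \<Longrightarrow> continuous_on UNIV (hvec (X i))"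
  using C_diff_on_hvec[of i 0] by simp

text \<open>Both sides are compared by pairing with the frame. The pairings of
  \<open>annihilator\<close> with the frame are constant along a straight extremal, so the
  discrepancy reduces to pairings with brackets.\<close>

lemma annihilator_derivative:
  assumes straight: "\<And>s. hh 3 s = 0"
  shows "(annihilator has_vector_derivative
    snd (hh 1 t *\<^sub>R hvec (X 1) (\<gamma> t, annihilator t) + hh 2 t *\<^sub>R hvec (X 2) (\<gamma> t, annihilator t))) (at t)"
    (is "(_ has_vector_derivative ?V) _")
proof -
  let ?x = "\<gamma> t" and ?p = "annihilator t"
  let ?v = "hh 1 t *\<^sub>R X 1 ?x + hh 2 t *\<^sub>R X 2 ?x"
  let ?D = "\<lambda>f. frechet_derivative f (at ?x)"
  have along: "((\<lambda>s. f (\<gamma> s)) has_vector_derivative ?D f ?v) (at t)"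
    if "f differentiable (at ?x)" for f :: field5
    using vector_derivative_diff_chain_within[OF \<gamma>_derivative has_derivative_at_withinI]
      that by (simp add: frechet_derivative_works o_def)
  have u: "(hh 1 has_real_derivative 0) (at t)" "(hh 2 has_real_derivative 0) (at t)"
    using hh_derivatives(1,2)[of t] straight by simp_all
  define p' where "p' = hh 1 t *\<^sub>R ?D (\<omega> 5) ?v - hh 2 t *\<^sub>R ?D (\<omega> 4) ?v"
  have scaled: "((\<lambda>s. hh i s *\<^sub>R \<omega> k (\<gamma> s)) has_vector_derivative hh i t *\<^sub>R ?D (\<omega> k) ?v) (at t)"
    if "(hh i has_real_derivative 0) (at t)" "k \<in> {1..5}" for i k
    using has_vector_derivative_scaleR[OF that(1) along[OF coframe_differentiable[OF that(2)]]] by simp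
  have p': "(annihilator has_vector_derivative p') (at t)"
    unfolding annihilator_def[abs_def] p'_def
    by (intro has_vector_derivative_diff scaled u) simp_all
  have p'_X: "p' \<bullet> X i ?x = - (?p \<bullet> ?D (X i) ?v)" if i: "i \<in> {1..5}" for i
  proof -
    have "((\<lambda>s. annihilator s \<bullet> X i (\<gamma> s)) has_vector_derivative ?p \<bullet> ?D (X i) ?v + p' \<bullet> X i ?x) (at t)"
      by (rule bounded_bilinear.has_vector_derivative[OF bounded_bilinear_inner p' along[OF X_differentiable[OF i]]])
    then have "((\<lambda>s. annihilator s \<bullet> X i (\<gamma> s)) has_real_derivative ?p \<bullet> ?D (X i) ?v + p' \<bullet> X i ?x) (at t)"
      by (simp add: has_real_derivative_iff_has_vector_derivative)
    moreover have "((\<lambda>s. annihilator s \<bullet> X i (\<gamma> s)) has_real_derivative 0) (at t)"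
    proof -
      consider "i = 1" | "i = 2" | "i = 3" | "i = 4" | "i = 5" using i by (auto simp: atLeastAtMost_1_5)
      then show ?thesis by cases (use u DERIV_minus[OF u(2)] in \<open>simp_all add: annihilator_X\<close>)
    qed
    ultimately have "?p \<bullet> ?D (X i) ?v + p' \<bullet> X i ?x = 0" by (rule DERIV_unique)
    then show ?thesis by simp
  qed
  have V_X: "?V \<bullet> X i ?x = p' \<bullet> X i ?x" if i: "i \<in> {1..5}" for i
  proof -
    note lin = linear_frechet_derivative[OF X_differentiable[OF i]]
    have "?V \<bullet> X i ?x = - (hh 1 t * (?p \<bullet> ?D (X 1) (X i ?x)) + hh 2 t * (?p \<bullet> ?D (X 2) (X i ?x)))"
      by (simp add: inner_add_left inner_snd_hvec X_differentiable)
    moreover have "?D (X i) ?v = hh 1 t *\<^sub>R ?D (X i) (X 1 ?x) + hh 2 t *\<^sub>R ?D (X i) (X 2 ?x)"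
      by (simp add: linear_add[OF lin] linear_scale[OF lin])
    \<comment> \<open>The brackets of the velocity combination with the frame are multiples of
      \<open>X 3\<close>, the vector \<open>A t\<close>, or zero, all annihilated.\<close>
    moreover have "hh 1 t * (?p \<bullet> lie_bracket (X 1) (X i) ?x) + hh 2 t * (?p \<bullet> lie_bracket (X 2) (X i) ?x) = 0"
    proof -
      consider "i = 1" | "i = 2" | "i = 3" | "i = 4" | "i = 5" using i by (auto simp: atLeastAtMost_1_5)
      then show ?thesis by cases (simp_all add: brackets_12 annihilator_X)
    qed
    ultimately show ?thesis
      unfolding p'_X[OF i] by (simp add: lie_bracket_def inner_diff_right inner_add_right algebra_simps)
  qed
  \<comment> \<open>Being orthogonal to the whole frame, the difference is orthogonal to
    itself.\<close>
  let ?d = "?V - p'"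
  have "?d \<bullet> ?d = ?d \<bullet> (\<Sum>j\<in>{1..5}. (\<omega> j ?x \<bullet> ?d) *\<^sub>R X j ?x)"
    by (simp only: expand)
  also have "\<dots> = (\<Sum>j\<in>{1..5}. (\<omega> j ?x \<bullet> ?d) * (?d \<bullet> X j ?x))"
    by (simp add: inner_sum_right)
  also have "\<dots> = 0"
    by (intro sum.neutral ballI) (simp only: inner_diff_left V_X diff_self mult_zero_right)
  finally have "?V = p'" by simp
  with p' show ?thesis by simp
qed

text \<open>The lift is driven by the controls of the extremal and solves its equation at every
  time. Its velocity \<open>G\<close> is continuous, hence bounded on compact intervals, which gives
  the Lipschitz constants.\<close>

lemma abnormal_straight:
  assumes straight: "\<And>s. hh 3 s = 0"
  shows "abnormal X \<gamma>"
proof -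
  define \<eta> where "\<eta> t = (\<gamma> t, annihilator t)" for t
  define G where "G t = hh 1 t *\<^sub>R hvec (X 1) (\<eta> t) + hh 2 t *\<^sub>R hvec (X 2) (\<eta> t)" for t
  have \<eta>': "(\<eta> has_vector_derivative G t) (at t)" for t
  proof -
    have "(\<eta> has_vector_derivative (hh 1 t *\<^sub>R X 1 (\<gamma> t) + hh 2 t *\<^sub>R X 2 (\<gamma> t), snd (G t))) (at t)"
      unfolding \<eta>_def[abs_def] G_def
      by (rule has_vector_derivative_Pair[OF \<gamma>_derivative annihilator_derivative[OF straight]])
    moreover have "G t = (hh 1 t *\<^sub>R X 1 (\<gamma> t) + hh 2 t *\<^sub>R X 2 (\<gamma> t), snd (G t))"
      by (simp add: G_def hvec_def \<eta>_def)
    ultimately show ?thesis by simp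
  qed
  have "continuous_on UNIV \<eta>"
    using \<eta>' has_vector_derivative_continuous by (blast intro: continuous_at_imp_continuous_on)
  moreover have "continuous_on UNIV (hh i)" if "(\<And>t. \<exists>d. (hh i has_real_derivative d) (at t))" for i
    using that DERIV_isCont by (blast intro: continuous_at_imp_continuous_on)
  ultimately have G_cont: "continuous_on UNIV G"
    unfolding G_def[abs_def] using hh_derivatives(1,2)
    by (intro continuous_intros continuous_on_compose2[OF continuous_hvec]) auto
  have lipschitz: "\<exists>L. L-lipschitz_on {a..b} \<eta>" for a b
  proof -
    have "bounded (G ` {a..b})"
      by (intro compact_imp_bounded compact_continuous_image continuous_on_subset[OF G_cont]) auto
    then obtain C where C: "C > 0" "\<And>t. t \<in> {a..b} \<Longrightarrow> norm (G t) \<le> C"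
      unfolding bounded_pos by auto
    have "C-lipschitz_on {a..b} \<eta>"
    proof (rule bounded_derivative_imp_lipschitz)
      show "(\<eta> has_derivative (\<lambda>v. v *\<^sub>R G t)) (at t within {a..b})" for t
        using \<eta>'[of t] by (auto simp: has_vector_derivative_def intro: has_derivative_at_withinI)
      show "onorm (\<lambda>v. v *\<^sub>R G t) \<le> C" if "t \<in> {a..b}" for t
        using C(2)[OF that] by (intro onorm_le) (simp add: mult.commute[of C] mult_left_mono)
    qed (use C in auto)
    then show ?thesis ..
  qed
  show ?thesis
    unfolding abnormal_def
  proof (rule exI[of _ "hh 1"], rule exI[of _ "hh 2"], rule exI[of _ \<eta>], intro conjI allI)
    show "(\<gamma> has_vector_derivative hh 1 t *\<^sub>R X 1 (\<gamma> t) + hh 2 t *\<^sub>R X 2 (\<gamma> t)) (at t)" for t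
      by (rule \<gamma>_derivative)
    show "fst (\<eta> t) = \<gamma> t" "snd (\<eta> t) \<noteq> 0" for t
      using annihilator_nonzero by (simp_all add: \<eta>_def)
    show "\<exists>L. L-lipschitz_on {a..b} \<eta>" for a b by (rule lipschitz)
    show "AE t in lborel. (\<eta> has_vector_derivative
         hh 1 t *\<^sub>R hamiltonian_field (h X 1) (\<eta> t) + hh 2 t *\<^sub>R hamiltonian_field (h X 2) (\<eta> t)) (at t)"
      using \<eta>' by (simp add: hamiltonian_field_h X_differentiable G_def)
    show "h X 1 (\<eta> t) = 0" "h X 2 (\<eta> t) = 0" for t
      by (simp_all add: h_def \<eta>_def annihilator_X)
  qed
qed

end

section \<open>The pendulum equation\<close>

lemma monotone_bounded_convergent_at_top:
  fixes f :: "real \<Rightarrow> real"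
  assumes mono: "\<And>s t. t0 \<le> s \<Longrightarrow> s \<le> t \<Longrightarrow> f s \<le> f t" and bound: "\<And>t. f t \<le> M"
  obtains l where "(f \<longlongrightarrow> l) at_top"
proof -
  let ?l = "SUP t\<in>{t0..}. f t"
  have bdd: "bdd_above (f ` {t0..})" using bound by (auto intro: bdd_aboveI[of _ M])
  have "(f \<longlongrightarrow> ?l) at_top"
  proof (rule increasing_tendsto)
    show "\<forall>\<^sub>F t in at_top. f t \<le> ?l"
      using eventually_ge_at_top[of t0] by eventually_elim (simp add: cSUP_upper bdd)
    fix x assume "x < ?l"
    then obtain s where s: "s \<ge> t0" "x < f s"
      using less_cSUP_iff[OF _ bdd] by auto
    show "\<forall>\<^sub>F t in at_top. x < f t"
      using eventually_ge_at_top[of s] by eventually_elim (use s mono in \<open>force intro: less_le_trans\<close>)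
  qed
  then show ?thesis by (rule that)
qed

text \<open>The increments over unit intervals tend to zero, and by the mean value theorem they are
  values of \<open>f'\<close> at points tending to infinity.\<close>

lemma derivative_limit_zero:
  fixes f f' :: "real \<Rightarrow> real"
  assumes der: "\<And>t. (f has_real_derivative f' t) (at t)"
    and lim: "(f \<longlongrightarrow> l) at_top" "(f' \<longlongrightarrow> m) at_top"
  shows "m = 0"
proof -
  have "\<exists>z>x. z < x + 1 \<and> f (x + 1) - f x = f' z" for x
    using MVT2[of x "x + 1" f f'] der by auto
  then obtain z where z: "\<And>x. x < z x" "\<And>x. f (x + 1) - f x = f' (z x)" by metis
  have "filterlim z at_top at_top"
    by (rule filterlim_at_top_mono[OF filterlim_ident]) (use z(1) in \<open>auto intro: less_imp_le always_eventually\<close>)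
  then have "((\<lambda>x. f' (z x)) \<longlongrightarrow> m) at_top"
    using filterlim_compose[OF lim(2)] by blast
  moreover have "((\<lambda>x. f (x + 1) - f x) \<longlongrightarrow> l - l) at_top"
    by (intro tendsto_diff lim(1) filterlim_compose[OF lim(1)] filterlim_at_top_mono[OF filterlim_ident])
       (auto intro: always_eventually)
  ultimately show ?thesis
    using tendsto_unique[OF trivial_limit_at_top_linorder] by (simp add: z(2))
qed

text \<open>An exponential weight makes \<open>f\<close> monotone on either side of
  \<open>t0\<close>, so nonnegativity pins it to zero both forwards and backwards in time.\<close>

lemma gronwall_zero:
  fixes f f' :: "real \<Rightarrow> real"
  assumes der: "\<And>t. (f has_real_derivative f' t) (at t)"
    and bound: "\<And>t. \<bar>f' t\<bar> \<le> K * f t" and "f t0 = 0" "\<And>t. f t \<ge> 0"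
  shows "f t = 0"
proof (cases "t0 \<le> t")
  case True
  have "f t * exp (- K * t) \<le> f t0 * exp (- K * t0)"
  proof (rule DERIV_nonpos_imp_nonincreasing[OF True], intro exI conjI)
    fix x
    show "((\<lambda>x. f x * exp (- K * x)) has_real_derivative (f' x - K * f x) * exp (- K * x)) (at x)"
      by (auto intro!: derivative_eq_intros der simp: algebra_simps)
    show "(f' x - K * f x) * exp (- K * x) \<le> 0"
      using bound[of x] by (intro mult_nonpos_nonneg) auto
  qed
  then have "f t \<le> 0" using assms(3) by (simp add: mult_le_0_iff not_le[symmetric])
  then show ?thesis using assms(4)[of t] by simp
next
  case False
  then have "t \<le> t0" by simp
  have "f t * exp (K * t) \<le> f t0 * exp (K * t0)"
  proof (rule DERIV_nonneg_imp_nondecreasing[OF \<open>t \<le> t0\<close>], intro exI conjI)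
    fix x
    show "((\<lambda>x. f x * exp (K * x)) has_real_derivative (f' x + K * f x) * exp (K * x)) (at x)"
      by (auto intro!: derivative_eq_intros der simp: algebra_simps)
    show "(f' x + K * f x) * exp (K * x) \<ge> 0"
      using bound[of x] by (intro mult_nonneg_nonneg) auto
  qed
  then have "f t \<le> 0" using assms(3) by (simp add: mult_le_0_iff not_le[symmetric])
  then show ?thesis using assms(4)[of t] by simp
qed

text \<open>Here \<open>a\<close> and \<open>b\<close> stand for the cosine and sine of the angle \<open>\<theta> - \<beta>\<close> of the pendulum, and
  \<open>c\<close> for its angular velocity.\<close>

locale pendulum =
  fixes a b c :: "real \<Rightarrow> real" and \<alpha> E :: real
  assumes a': "(a has_real_derivative - b t * c t) (at t)"
    and b': "(b has_real_derivative a t * c t) (at t)"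
    and c': "(c has_real_derivative - \<alpha> * b t) (at t)"
    and circle: "(a t)\<^sup>2 + (b t)\<^sup>2 = 1"
    and energy: "(c t)\<^sup>2 / 2 - \<alpha> * a t = E"
    and \<alpha>_nonneg: "\<alpha> \<ge> 0"
begin

text \<open>Uniqueness of solutions, via Gronwall for the squared distance \<open>f\<close> to the
  equilibrium. Working in both time directions, it also shows that no other motion reaches this
  point.\<close>

lemma equilibrium:
  assumes "a t0 = -1" "c t0 = 0" shows "a t = -1 \<and> c t = 0"
proof -
  define f where "f t = (a t + 1)\<^sup>2 + (b t)\<^sup>2 + (c t)\<^sup>2" for t
  have "b t0 = 0" using circle[of t0] assms by simp
  have "f t = 0"
  proof (rule gronwall_zero[of f])
    show "(f has_real_derivative - (1 + \<alpha>) * (2 * b t * c t)) (at t)" for t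
      unfolding f_def[abs_def]
      by (auto intro!: derivative_eq_intros a' b' c' simp: algebra_simps)
    show "\<bar>- (1 + \<alpha>) * (2 * b t * c t)\<bar> \<le> (1 + \<alpha>) * f t" for t
    proof -
      have "0 \<le> (\<bar>b t\<bar> - \<bar>c t\<bar>)\<^sup>2" by simp
      then have "2 * \<bar>b t\<bar> * \<bar>c t\<bar> \<le> (b t)\<^sup>2 + (c t)\<^sup>2" by (simp add: power2_diff)
      also have "\<dots> \<le> f t" by (simp add: f_def)
      finally have "(1 + \<alpha>) * (2 * \<bar>b t\<bar> * \<bar>c t\<bar>) \<le> (1 + \<alpha>) * f t"
        using \<alpha>_nonneg by (intro mult_left_mono) simp_all
      moreover have "\<bar>- (1 + \<alpha>) * (2 * b t * c t)\<bar> = (1 + \<alpha>) * (2 * \<bar>b t\<bar> * \<bar>c t\<bar>)"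
        using \<alpha>_nonneg by (simp only: abs_mult)
      ultimately show ?thesis by simp
    qed
    show "f t0 = 0" by (simp add: f_def assms \<open>b t0 = 0\<close>)
    show "f t \<ge> 0" for t by (simp add: f_def)
  qed
  then have "(a t + 1)\<^sup>2 = 0 \<and> (c t)\<^sup>2 = 0"
    unfolding f_def by (smt (verit) zero_le_power2)
  then show ?thesis by auto
qed

text \<open>If \<open>c\<close> stayed positive, the half-angle tangent \<open>y = b / (1 + a)\<close> would increase to a finite
  limit, so the motion would converge to an equilibrium; but both equilibria have
  energy \<open>\<plusminus>\<alpha>\<close>.\<close>

lemma not_eventually_positive:
  assumes "\<bar>E\<bar> < \<alpha>" and pos: "\<And>t. t \<ge> t0 \<Longrightarrow> c t > 0"
  shows False
proof -
  define y where "y t = b t / (1 + a t)" for t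
  have \<alpha>: "\<alpha> > 0" using assms(1) by linarith
  \<comment> \<open>As the kinetic term is nonnegative, the energy identity gives a \<ge>
    -E/\<alpha>. Thus \<open>d\<close> bounds \<open>1 + a\<close> below uniformly, and E < \<alpha>
    makes it positive.\<close>
  define d where "d = 1 - E / \<alpha>"
  have d: "d > 0" using assms(1) \<alpha> by (simp add: d_def)
  have a_ge: "1 + a t \<ge> d" for t
  proof -
    have "\<alpha> * a t \<ge> - E" using energy[of t] by (smt (verit) zero_le_power2 divide_nonneg_pos)
    then have "a t \<ge> - E / \<alpha>"
      using pos_divide_le_eq[OF \<alpha>, of "- E" "a t"] by (simp only: mult.commute)
    then show ?thesis by (simp add: d_def)
  qed
  have a_pos: "1 + a t > 0" for t using a_ge[of t] d by linarith
  have y': "(y has_real_derivative c t / (1 + a t)) (at t)" for t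
  proof -
    have "(y has_real_derivative (a t * c t * (1 + a t) - b t * (- b t * c t)) / ((1 + a t) * (1 + a t))) (at t)"
      unfolding y_def[abs_def] using a_pos[of t]
      by (auto intro!: derivative_eq_intros a' b')
    moreover have "a t * c t * (1 + a t) - b t * (- b t * c t) = c t * (1 + a t)"
      using circle[of t] by algebra
    ultimately show ?thesis using a_pos[of t] by simp
  qed
  have "y s \<le> y t" if "t0 \<le> s" "s \<le> t" for s t
    by (rule DERIV_nonneg_imp_nondecreasing[OF that(2)])
       (use y' pos a_pos that(1) in \<open>meson divide_nonneg_pos less_imp_le order_trans\<close>)
  moreover have "y t \<le> 1 / d" for t
  proof -
    have "b t \<le> 1" using circle[of t] by (metis abs_le_D1 abs_square_le_1 le_add_same_cancel2 zero_le_power2)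
    then have "b t / (1 + a t) \<le> 1 / (1 + a t)"
      using a_pos[of t] by (intro divide_right_mono) simp_all
    also have "\<dots> \<le> 1 / d" using a_ge[of t] d by (intro divide_left_mono) simp_all
    finally show ?thesis by (simp add: y_def)
  qed
  ultimately obtain L where L: "(y \<longlongrightarrow> L) at_top"
    using monotone_bounded_convergent_at_top[of t0 y "1 / d"] by blast
  have y2: "(y t)\<^sup>2 = (1 - a t) / (1 + a t)" for t
  proof -
    have "(b t)\<^sup>2 = (1 - a t) * (1 + a t)" using circle[of t] by algebra
    then show ?thesis using a_pos[of t] by (simp add: y_def power_divide power2_eq_square)
  qed
  have a_y: "a t = (1 - (y t)\<^sup>2) / (1 + (y t)\<^sup>2)" for t
    using a_pos[of t] unfolding y2 by (simp add: divide_simps)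
  have b_y: "b t = y t * (1 + a t)" for t
    using a_pos[of t] by (simp add: y_def)
  \<comment> \<open>The rational parametrization of the circle by the half-angle tangent turns the
    limit of \<open>y\<close> into limits of \<open>a\<close> and \<open>b\<close>.\<close>
  define A where "A = (1 - L\<^sup>2) / (1 + L\<^sup>2)"
  have L1: "1 + L\<^sup>2 \<noteq> 0" by (smt (verit) zero_le_power2)
  have A: "(a \<longlongrightarrow> A) at_top"
    unfolding A_def by (subst a_y[abs_def]) (intro tendsto_intros L L1)
  have B: "(b \<longlongrightarrow> L * (1 + A)) at_top"
    by (subst b_y[abs_def]) (intro tendsto_intros L A)
  \<comment> \<open>Positivity selects the root in the energy identity, so \<open>c\<close>
    converges together with \<open>a\<close>.\<close>
  have "\<forall>\<^sub>F t in at_top. sqrt (2 * (E + \<alpha> * a t)) = c t"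
    using eventually_ge_at_top[of t0]
  proof eventually_elim
    case (elim t)
    have "2 * (E + \<alpha> * a t) = (c t)\<^sup>2" using energy[of t] by (simp add: field_simps)
    then show ?case using pos[OF elim] by simp
  qed
  moreover have "((\<lambda>t. sqrt (2 * (E + \<alpha> * a t))) \<longlongrightarrow> sqrt (2 * (E + \<alpha> * A))) at_top"
    by (intro tendsto_intros A)
  ultimately have C: "(c \<longlongrightarrow> sqrt (2 * (E + \<alpha> * A))) at_top"
    by (rule Lim_transform_eventually[rotated])
  have A1: "1 + A \<noteq> 0" using L1 by (simp add: A_def field_simps)
  \<comment> \<open>The limit of y' must be zero, so c tends to 0; the limit of c' must be zero, so
    b tends to 0. Then \<open>L = 0\<close>, \<open>A = 1\<close> and E = -\<alpha>, a
    contradiction.\<close>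
  have "sqrt (2 * (E + \<alpha> * A)) / (1 + A) = 0"
    by (rule derivative_limit_zero[OF y' L]) (intro tendsto_intros A A1 C)
  then have EA: "E + \<alpha> * A = 0" using A1 by simp
  have "- \<alpha> * (L * (1 + A)) = 0"
    by (rule derivative_limit_zero[OF c' C]) (intro tendsto_intros B)
  then have "L = 0" using \<alpha> A1 by simp
  then show False using EA assms(1) by (simp add: A_def)
qed

text \<open>Beyond finitely many zeros \<open>c\<close> would keep one sign for ever, which
  \<open>not_eventually_positive\<close> excludes.\<close>

lemma infinite_zeros:
  assumes "\<bar>E\<bar> < \<alpha>" shows "infinite {t. c t = 0}"
proof
  assume "finite {t. c t = 0}"
  then have "bdd_above {t. c t = 0}" by (rule bdd_above_finite)
  then obtain M where "\<And>t. c t = 0 \<Longrightarrow> t \<le> M" by (auto simp: bdd_above_def)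
  then have nz: "c t \<noteq> 0" if "t \<ge> M + 1" for t using that by fastforce
  have cont: "isCont c t" for t using c' DERIV_isCont by blast
  have same_sign: "c s * c t > 0" if "M + 1 \<le> s" "s \<le> t" for s t
  proof (rule ccontr)
    assume "\<not> c s * c t > 0"
    then have "c s \<le> 0 \<and> 0 \<le> c t \<or> c t \<le> 0 \<and> 0 \<le> c s"
      by (auto simp: zero_less_mult_iff not_less)
    then have "\<exists>x. s \<le> x \<and> x \<le> t \<and> c x = 0"
      using IVT[of c s 0 t] IVT2[of c t 0 s] that cont by blast
    then show False using nz that by auto
  qed
  show False
  proof (cases "c (M + 1) > 0")
    case True
    show False
      by (rule not_eventually_positive[OF assms, of "M + 1"])
         (use same_sign[of "M + 1"] True in \<open>auto simp: zero_less_mult_iff\<close>)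
  next
    case False
    \<comment> \<open>Reversing the angle exchanges the two senses of motion and turns negative
      velocity into positive.\<close>
    interpret reflected: pendulum a "\<lambda>t. - b t" "\<lambda>t. - c t" \<alpha> E
    proof
      show "(a has_real_derivative - (- b t) * (- c t)) (at t)" for t
        using a'[of t] by simp
      show "((\<lambda>t. - b t) has_real_derivative a t * (- c t)) (at t)" for t
        using DERIV_minus[OF b'[of t]] by simp
      show "((\<lambda>t. - c t) has_real_derivative - \<alpha> * (- b t)) (at t)" for t
        using DERIV_minus[OF c'[of t]] by simp
    qed (use circle energy \<alpha>_nonneg in simp_all)
    show False
      by (rule reflected.not_eventually_positive[OF assms, of "M + 1"])
         (use same_sign[of "M + 1"] False in \<open>auto simp: zero_less_mult_iff\<close>)
  qed
qed

end

section \<open>The vertical dynamics on the cylinder\<close>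

lemma cos_eq_minus_1_rcong: "cos x = -1 \<longleftrightarrow> [x = pi] (rmod (2 * pi))"
proof -
  have "cos x = -1 \<longleftrightarrow> cis x = cis pi"
    using sin_cos_squared_add[of x] by (cases "cos x = -1") (simp_all add: complex_eq_iff)
  then show ?thesis by (simp only: cis_eq_iff)
qed

context normal_extremal
begin

text \<open>The constant pair (-h_5, h_4) is \<alpha> times the unit vector of angle \<beta>.
  Measured from that fixed direction, the controls become the cosine and sine of the pendulum
  angle.\<close>

lemma pendulum_coords:
  assumes "coords X (\<phi> 0) \<theta> c \<alpha> \<beta>"
  shows "pendulum (\<lambda>t. hh 1 t * cos \<beta> + hh 2 t * sin \<beta>) (\<lambda>t. hh 2 t * cos \<beta> - hh 1 t * sin \<beta>)
    (hh 3) \<alpha> (energy X (\<phi> 0))" (is "pendulum ?a ?b _ _ _")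
proof -
  have h45: "hh 4 t = \<alpha> * sin \<beta>" "hh 5 t = - \<alpha> * cos \<beta>" for t
    using assms hh_const[of t] by (simp_all add: coords_def)
  have d: "(?a has_real_derivative - ?b t * hh 3 t) (at t)"
    "(?b has_real_derivative ?a t * hh 3 t) (at t)"
    "(hh 3 has_real_derivative - \<alpha> * ?b t) (at t)" for t
  proof -
    show "(?a has_real_derivative - ?b t * hh 3 t) (at t)"
      by (rule derivative_eq_intros hh_derivatives refl)+ (simp add: algebra_simps)
    show "(?b has_real_derivative ?a t * hh 3 t) (at t)"
      by (rule derivative_eq_intros hh_derivatives refl)+ (simp add: algebra_simps)
    show "(hh 3 has_real_derivative - \<alpha> * ?b t) (at t)"
      using hh_derivatives(3)[of t] by (simp add: h45 algebra_simps)
  qed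
  have "((\<lambda>t. (hh 3 t)\<^sup>2 / 2 - \<alpha> * ?a t) has_real_derivative 0) (at t)" for t
    by (rule DERIV_cong[OF DERIV_diff[OF DERIV_cdivide[OF DERIV_power[OF d(3)]] DERIV_cmult[OF d(1)]]])
       (simp add: field_simps)
  then have "(hh 3 t)\<^sup>2 / 2 - \<alpha> * ?a t = (hh 3 0)\<^sup>2 / 2 - \<alpha> * ?a 0" for t
    using DERIV_isconst_all[of "\<lambda>t. (hh 3 t)\<^sup>2 / 2 - \<alpha> * ?a t" t 0] by blast
  also have "(hh 3 0)\<^sup>2 / 2 - \<alpha> * ?a 0 = energy X (\<phi> 0)"
    by (simp add: energy_def h45 algebra_simps)
  finally have en: "(hh 3 t)\<^sup>2 / 2 - \<alpha> * ?a t = energy X (\<phi> 0)" for t .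
  have circle: "(?a t)\<^sup>2 + (?b t)\<^sup>2 = 1" for t
  proof -
    have "(?a t)\<^sup>2 + (?b t)\<^sup>2 = ((hh 1 t)\<^sup>2 + (hh 2 t)\<^sup>2) * ((cos \<beta>)\<^sup>2 + (sin \<beta>)\<^sup>2)" by algebra
    then show ?thesis by (simp add: unit)
  qed
  show ?thesis
    by unfold_locales (use d en circle assms in \<open>simp_all add: coords_def\<close>)
qed

text \<open>A simple zero is isolated, because the difference quotient stays away from zero.\<close>

lemma not_equiregular_zero:
  assumes "hh 3 t = 0" "(hh 3 has_real_derivative d) (at t)" "d \<noteq> 0"
  shows "\<not> equiregular_at X \<gamma> t"
proof (rule not_equiregularI[OF assms(1)])
  have "((\<lambda>s. (hh 3 s - hh 3 t) / (s - t)) \<longlongrightarrow> d) (at t)"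
    using assms(2) by (simp add: has_field_derivative_iff)
  then have "\<forall>\<^sub>F s in at t. (hh 3 s - hh 3 t) / (s - t) \<noteq> 0"
    using assms(3) tendsto_imp_eventually_ne by blast
  then show "\<forall>\<^sub>F s in at t. hh 3 s \<noteq> 0"
    by eventually_elim (auto simp: assms(1))
qed

lemma infinite_not_equiregular:
  assumes "\<phi> 0 \<in> C1 X x0" shows "infinite {t. \<not> equiregular_at X \<gamma> t}"
proof -
  obtain \<theta> c \<alpha> \<beta> where coords: "coords X (\<phi> 0) \<theta> c \<alpha> \<beta>" and E: "\<bar>energy X (\<phi> 0)\<bar> < \<alpha>"
    using assms unfolding C1_def by (auto simp: abs_less_iff)
  interpret pendulum "\<lambda>t. hh 1 t * cos \<beta> + hh 2 t * sin \<beta>" "\<lambda>t. hh 2 t * cos \<beta> - hh 1 t * sin \<beta>"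
    "hh 3" \<alpha> "energy X (\<phi> 0)" by (rule pendulum_coords[OF coords])
  let ?a = "\<lambda>t. hh 1 t * cos \<beta> + hh 2 t * sin \<beta>" and ?b = "\<lambda>t. hh 2 t * cos \<beta> - hh 1 t * sin \<beta>"
  have "\<not> equiregular_at X \<gamma> t" if t: "hh 3 t = 0" for t
  proof (rule not_equiregular_zero[OF t c'])
    \<comment> \<open>At a turning point with sine zero the cosine would be 1 or -1 and the energy
      -\<alpha> or \<alpha>, both excluded on \<open>C1\<close>.\<close>
    have "?b t \<noteq> 0"
    proof
      assume "?b t = 0"
      then have "(?a t)\<^sup>2 = 1" using circle[of t] by simp
      then have "?a t = 1 \<or> ?a t = - 1" by (simp add: power2_eq_1_iff)
      then show False using energy[of t] t E by auto
    qed
    then show "- \<alpha> * ?b t \<noteq> 0" using E by auto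
  qed
  then have "{t. hh 3 t = 0} \<subseteq> {t. \<not> equiregular_at X \<gamma> t}" by blast
  then show ?thesis using infinite_zeros[OF E] infinite_super by blast
qed

text \<open>At a zero of h_3 the energy is -\<alpha> times the cosine, hence at most \<alpha>.
  Equality would place the pendulum at the equilibrium with cosine -1, then also at time 0. For
  \<alpha> = 0 the velocity h_3 is constant.\<close>

lemma nowhere_straight:
  assumes "\<phi> 0 \<in> C2 X x0 \<union> C3 X x0 \<union> C6 X x0" shows "hh 3 t \<noteq> 0"
proof -
  obtain \<theta> c \<alpha> \<beta> where coords: "coords X (\<phi> 0) \<theta> c \<alpha> \<beta>" and "(\<alpha> \<noteq> 0 \<and> energy X (\<phi> 0) > \<alpha>)
    \<or> (\<alpha> \<noteq> 0 \<and> energy X (\<phi> 0) = \<alpha> \<and> \<not> [\<theta> - \<beta> = pi] (rmod (2 * pi))) \<or> (\<alpha> = 0 \<and> c \<noteq> 0)"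
    using assms unfolding C2_def C3_def C6_def by auto
  then consider "\<alpha> \<noteq> 0" "energy X (\<phi> 0) > \<alpha>"
    | "\<alpha> \<noteq> 0" "energy X (\<phi> 0) = \<alpha>" "cos (\<theta> - \<beta>) \<noteq> -1" | "\<alpha> = 0" "c \<noteq> 0"
    by (auto simp: cos_eq_minus_1_rcong)
  note cases = this
  let ?a = "\<lambda>t. hh 1 t * cos \<beta> + hh 2 t * sin \<beta>" and ?b = "\<lambda>t. hh 2 t * cos \<beta> - hh 1 t * sin \<beta>"
  interpret pendulum ?a ?b "hh 3" \<alpha> "energy X (\<phi> 0)" by (rule pendulum_coords[OF coords])
  have a0: "?a 0 = cos (\<theta> - \<beta>)" using coords by (simp add: coords_def cos_diff)
  show ?thesis
  proof
    assume t: "hh 3 t = 0"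
    from cases show False
    proof cases
      case 1
      have "- ?a t \<le> 1" using circle[of t] by (metis abs_le_D2 abs_square_le_1 le_add_same_cancel1 zero_le_power2)
      then have "\<alpha> * (- ?a t) \<le> \<alpha> * 1" using \<alpha>_nonneg by (rule mult_left_mono)
      moreover have "- (\<alpha> * ?a t) = energy X (\<phi> 0)" using energy[of t] by (simp add: t)
      ultimately show False using 1(2) by (simp only: mult_minus_right mult_1_right)
    next
      case 2
      have "- (\<alpha> * ?a t) = \<alpha>" using energy[of t] 2(2) by (simp add: t)
      then have "\<alpha> * (?a t + 1) = 0" by (simp only: distrib_left mult_1_right)
      then have "?a t = -1" using 2(1) by (simp add: add_eq_0_iff)
      then have "?a 0 = -1" using equilibrium t by blast
      with 2 a0 show False by simp
    next
      case 3
      then have "hh 3 t = hh 3 0" using c' DERIV_isconst_all[of "hh 3" t 0] by simp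
      with 3 t coords show False by (simp add: coords_def)
    qed
  qed
qed

text \<open>Energy -\<alpha> is the minimum of the potential and leaves no kinetic term. Energy
  \<alpha> at angle pi forces zero initial velocity, so the motion starts and stays at the
  equilibrium. For \<alpha> = 0 the velocity h_3 is constant.\<close>

lemma straight:
  assumes "\<phi> 0 \<in> C4 X x0 \<union> C5 X x0 \<union> C7 X x0" shows "hh 3 t = 0"
proof -
  obtain \<theta> c \<alpha> \<beta> where coords: "coords X (\<phi> 0) \<theta> c \<alpha> \<beta>" and "(\<alpha> \<noteq> 0 \<and> energy X (\<phi> 0) = - \<alpha>)
    \<or> (\<alpha> \<noteq> 0 \<and> energy X (\<phi> 0) = \<alpha> \<and> [\<theta> - \<beta> = pi] (rmod (2 * pi))) \<or> (\<alpha> = 0 \<and> c = 0)"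
    using assms unfolding C4_def C5_def C7_def by auto
  then consider "\<alpha> \<noteq> 0" "energy X (\<phi> 0) = - \<alpha>"
    | "\<alpha> \<noteq> 0" "energy X (\<phi> 0) = \<alpha>" "cos (\<theta> - \<beta>) = -1" | "\<alpha> = 0" "c = 0"
    by (auto simp: cos_eq_minus_1_rcong)
  note cases = this
  let ?a = "\<lambda>t. hh 1 t * cos \<beta> + hh 2 t * sin \<beta>" and ?b = "\<lambda>t. hh 2 t * cos \<beta> - hh 1 t * sin \<beta>"
  interpret pendulum ?a ?b "hh 3" \<alpha> "energy X (\<phi> 0)" by (rule pendulum_coords[OF coords])
  have a0: "?a 0 = cos (\<theta> - \<beta>)" using coords by (simp add: coords_def cos_diff)
  from cases show ?thesis
  proof cases
    case 1
    have "?a t \<le> 1" using circle[of t] by (metis abs_le_D1 abs_square_le_1 le_add_same_cancel1 zero_le_power2)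
    then have "\<alpha> * ?a t \<le> \<alpha> * 1" using \<alpha>_nonneg by (rule mult_left_mono)
    then have "(hh 3 t)\<^sup>2 \<le> 0" using energy[of t] 1(2) by linarith
    then show ?thesis by simp
  next
    case 2
    then have a0': "?a 0 = -1" using a0 by simp
    have "(hh 3 0)\<^sup>2 / 2 = 0" using energy[of 0] 2 unfolding a0' by simp
    then have "hh 3 0 = 0" by simp
    with a0' show ?thesis using equilibrium by blast
  next
    case 3
    then have "hh 3 t = hh 3 0" using c' DERIV_isconst_all[of "hh 3" t 0] by simp
    with 3 coords show ?thesis by (simp add: coords_def)
  qed
qed

end

theorem proposition6p2:
  fixes m :: "real^5 \<Rightarrow> real^5 \<Rightarrow> real^5"
    and X :: "nat \<Rightarrow> field5"
    and x0 :: "real^5"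
    and \<xi> :: cotangent5
    and \<phi> :: "real \<Rightarrow> cotangent5"
    and \<gamma> :: "real \<Rightarrow> real^5"
  assumes cartan: "cartan_group m X"
    and covector: "\<xi> \<in> cylinder X x0"
    and extremal: "integral_curve (hamiltonian_field (Ham X)) \<phi>" "\<phi> 0 = \<xi>"
    and geodesic: "\<gamma> = (\<lambda>t. fst (\<phi> t))"
  shows "(\<xi> \<in> C1 X x0 \<longrightarrow> infinite {t. \<not> equiregular_at X \<gamma> t}) \<and>
         (\<xi> \<in> C2 X x0 \<union> C3 X x0 \<union> C6 X x0 \<longrightarrow> (\<forall>t. equiregular_at X \<gamma> t)) \<and>
         (\<xi> \<in> C4 X x0 \<union> C5 X x0 \<union> C7 X x0 \<longrightarrow> \<not> ample X \<gamma> \<and> abnormal X \<gamma>)"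
proof -
  obtain \<omega> where "cartan_frame X \<omega>"
    using cartan_group_coframe[OF cartan] .
  then interpret cartan_frame X \<omega> .
  interpret normal_extremal X \<omega> \<phi> \<gamma>
  proof
    show "(\<phi> has_vector_derivative Hvec (\<phi> t)) (at t)" for t
      using extremal(1) by (simp add: integral_curve_def hamiltonian_field_Ham_eq)
    show "(h X 1 (\<phi> 0))\<^sup>2 + (h X 2 (\<phi> 0))\<^sup>2 = 1"
      using covector by (simp add: extremal(2) cylinder_def Ham_def)
  qed (rule geodesic)
  show ?thesis
    using infinite_not_equiregular[of x0] equiregularI[OF nowhere_straight[of x0]]
      not_ample_straight[OF straight[of x0]] abnormal_straight[OF straight[of x0]]
    unfolding extremal(2) by blast
qed

end
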